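(* Consider the Dirichlet problem $\partial u/\partial t=D(t)\Delta u+A(x,t)u+B(u,x,t)$ in $\Omega$, $u|_{\partial\Omega}=0$, $u(x,0)=u_0(x)$, with the assumptions and notation given in the context, and let $u$ be its solution. Suppose that $$d(t)=\frac{d_0}{t+1},\qquad \gamma(t)=-\frac{\gamma_0}{(t+1)^k},\qquad \mu(t)=\mu_0(t+1)^m,$$ where $d_0,\gamma_0,\mu_0$ are positive constants, $k\ge1$ and $m$ are constants, that $$\alpha(t)\le\mu_0^{q-1}(t+1)^{m(q-1)}\left(c(\Omega)\frac{d_0}{t+1}-\frac{\gamma_0}{(t+1)^k}-\frac{m}{t+1}\right)\qquad\text{for all } t\ge0,$$ that $c(\Omega)d_0>\gamma_0+m$, and that $\mu_0=g(0)^{-1}$. Then $$\|u(\cdot,t)\|\le g(0)\,(t+1)^{-m}\qquad\text{for all } t\ge0 .$$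
   Context: $\Omega\subset\mathbb R^{\mathcal M}$, $\mathcal M\le 3$, is a bounded domain with sufficiently smooth boundary; $u=(u_1,\dots,u_n)$ is $\mathbb R^n$-valued; $D(t)$ is a diagonal matrix with positive diagonal elements $d_i(t)$, and $d_i(t)\ge d(t)$ for $i=1,\dots,n$, $t\ge0$, where $d(t)$ is a positive function. The nonlinearity $F(u,x,t)=A(x,t)u+B(u,x,t)$, with $A(x,t)$ an $n\times n$ matrix, satisfies: $F(0,x,t)=0$ for $x\in\Omega$, $t\ge0$; $\sup_{u\in\mathbb R^n,\,x\in\mathbb R^{\mathcal M},\,t\ge0}|F(u,x,t)|\le M_1$ for a constant $M_1$; $|F(v,x,t)-F(w,x,s)|\le c_F(|t-s|+|v-w|)$ with a constant $c_F>0$ independent of $v,w,x,t,s$; $F$ is continuous in $x$. Moreover $\mathrm{Re}\,(A(x,t)u,u)\le-\gamma(t)|u|^2$ and $|B(u,x,t)|\le c_0(t)|u|^p$ with $p>1$, for all $u$, $x\in\Omega$, $t\ge0$, where $(\cdot,\cdot)$ is the inner product in $\mathbb R^n$, $|u|^2=\sum_{j=1}^n|u_j|^2$, and $\gamma$ is a real-valued function (not necessarily of constant sign). The initial function satisfies the compatibility condition $u_0=0$ on $\partial\Omega$. By the solution $u$ we mean the classical solution on $\Omega\times[0,\infty)$, with $u(\cdot,t)\in H^2(\Omega)$ for $t\ge0$. $\|\cdot\|$ is the $L^2(\Omega)$ norm and $g(t)=\|u(\cdot,t)\|$; it is assumed that $g(0)\ne0$. $c(\Omega)>0$ is a constant in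 the Poincaré inequality $c(\Omega)\int_\Omega|u|^2dx\le\int_\Omega|\nabla u|^2dx$ for functions vanishing on $\partial\Omega$. $c>0$ is a constant, independent of $u$, such that $\|u\|_{L^\infty(\Omega)}\le c\,\|u\|_{L^2(\Omega)}^{1/4}\|u\|_{H^2(\Omega)}^{3/4}$ for all $u\in H^2(\Omega)$. Set $\sigma(t)=d(t)c(\Omega)+\gamma(t)$, $\alpha(t)=c_0(t)c^{p-1}\|u(\cdot,t)\|_{H^2(\Omega)}^{3(p-1)/4}$, $q=(p+3)/4$. The functions $\sigma(t)$ and $\alpha(t)\ge0$ are assumed continuous on $[0,\infty)$. *)

theory Defs
  imports "HOL-Analysis.Analysis" "HOL-Probability.Essential_Supremum"
begin

section \<open>Classical derivatives\<close>

definition partial_deriv ::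
    "'m::finite \<Rightarrow> (real ^ 'm \<Rightarrow> 'b::real_normed_vector) \<Rightarrow> real ^ 'm \<Rightarrow> 'b" where
  "partial_deriv i f x = frechet_derivative f (at x) (axis i 1)"

fun partial_derivs ::
    "'m::finite list \<Rightarrow> (real ^ 'm \<Rightarrow> 'b::real_normed_vector) \<Rightarrow> real ^ 'm \<Rightarrow> 'b" where
  "partial_derivs [] f = f"
| "partial_derivs (i # is) f = partial_deriv i (partial_derivs is f)"

definition laplacian :: "(real ^ 'm::finite \<Rightarrow> 'b::real_normed_vector) \<Rightarrow> real ^ 'm \<Rightarrow> 'b" where
  "laplacian f x = (\<Sum>i\<in>UNIV. partial_derivs [i, i] f x)"

text \<open>Only meaningful for an open set \<open>S\<close>, since the derivatives are taken in the whole space.\<close>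

fun Ck_on :: "nat \<Rightarrow> (real ^ 'm::finite \<Rightarrow> 'b::real_normed_vector) \<Rightarrow> (real ^ 'm) set \<Rightarrow> bool" where
  "Ck_on 0 f S \<longleftrightarrow> continuous_on S f"
| "Ck_on (Suc k) f S \<longleftrightarrow>
     (\<forall>x\<in>S. f differentiable (at x)) \<and> (\<forall>i. Ck_on k (partial_deriv i f) S)"

section \<open>Domains\<close>

text \<open>The boundary is of class \<open>C\<^sup>k\<close> and the set lies locally on one side of it, expressed by
  local defining functions with nonvanishing gradient. (By the implicit function theorem this is
  the usual description by graphs.)\<close>

definition Ck_boundary :: "nat \<Rightarrow> (real ^ 'm::finite) set \<Rightarrow> bool" where
  "Ck_boundary k \<Omega> \<longleftrightarrow>
     (\<forall>p\<in>frontier \<Omega>. \<exists>r>0. \<exists>\<rho> :: real ^ 'm \<Rightarrow> real.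
        Ck_on k \<rho> (ball p r) \<and>
        (\<forall>x\<in>ball p r. \<exists>i. partial_deriv i \<rho> x \<noteq> 0) \<and>
        \<Omega> \<inter> ball p r = {x \<in> ball p r. \<rho> x < 0})"

definition smooth_bounded_domain :: "(real ^ 'm::finite) set \<Rightarrow> bool" where
  "smooth_bounded_domain \<Omega> \<longleftrightarrow>
     open \<Omega> \<and> connected \<Omega> \<and> \<Omega> \<noteq> {} \<and> bounded \<Omega> \<and> Ck_boundary 2 \<Omega>"

section \<open>Lebesgue and Sobolev spaces\<close>

definition square_integrable ::
    "(real ^ 'm::finite) set \<Rightarrow> (real ^ 'm \<Rightarrow> 'b::euclidean_space) \<Rightarrow> bool" where
  "square_integrable \<Omega> v \<longleftrightarrow>
     v \<in> borel_measurable (lebesgue_on \<Omega>) \<and>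
     integrable (lebesgue_on \<Omega>) (\<lambda>x. (norm (v x))\<^sup>2)"

definition L2_norm :: "(real ^ 'm::finite) set \<Rightarrow> (real ^ 'm \<Rightarrow> 'b::euclidean_space) \<Rightarrow> real" where
  "L2_norm \<Omega> v = sqrt (\<integral>x. (norm (v x))\<^sup>2 \<partial>lebesgue_on \<Omega>)"

definition Linf_norm :: "(real ^ 'm::finite) set \<Rightarrow> (real ^ 'm \<Rightarrow> 'b::euclidean_space) \<Rightarrow> ereal" where
  "Linf_norm \<Omega> v = esssup (lebesgue_on \<Omega>) (\<lambda>x. ereal (norm (v x)))"

definition test_function :: "(real ^ 'm::finite) set \<Rightarrow> (real ^ 'm \<Rightarrow> real) \<Rightarrow> bool" where
  "test_function \<Omega> \<phi> \<longleftrightarrow>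
     (\<forall>k. Ck_on k \<phi> UNIV) \<and>
     compact (closure {x. \<phi> x \<noteq> 0}) \<and> closure {x. \<phi> x \<noteq> 0} \<subseteq> \<Omega>"

text \<open>\<open>w\<close> is a weak derivative of \<open>v\<close> in the directions listed in \<open>is\<close>, both functions being
  in \<open>L\<^sup>2(\<Omega>)\<close>.\<close>

definition has_weak_deriv ::
    "(real ^ 'm::finite) set \<Rightarrow> 'm list \<Rightarrow> (real ^ 'm \<Rightarrow> 'b::euclidean_space) \<Rightarrow> (real ^ 'm \<Rightarrow> 'b) \<Rightarrow> bool"
  where
  "has_weak_deriv \<Omega> is v w \<longleftrightarrow>
     square_integrable \<Omega> v \<and> square_integrable \<Omega> w \<and>
     (\<forall>\<phi>. test_function \<Omega> \<phi> \<longrightarrow>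
        (\<integral>x. partial_derivs is \<phi> x *\<^sub>R v x \<partial>lebesgue_on \<Omega>) =
        (-1) ^ length is *\<^sub>R (\<integral>x. \<phi> x *\<^sub>R w x \<partial>lebesgue_on \<Omega>))"

text \<open>A weak derivative is determined only almost everywhere.\<close>

definition weak_deriv ::
    "(real ^ 'm::finite) set \<Rightarrow> 'm list \<Rightarrow> (real ^ 'm \<Rightarrow> 'b::euclidean_space) \<Rightarrow> real ^ 'm \<Rightarrow> 'b" where
  "weak_deriv \<Omega> is v = (SOME w. has_weak_deriv \<Omega> is v w)"

definition in_Hk ::
    "nat \<Rightarrow> (real ^ 'm::finite) set \<Rightarrow> (real ^ 'm \<Rightarrow> 'b::euclidean_space) \<Rightarrow> bool" where
  "in_Hk k \<Omega> v \<longleftrightarrow> (\<forall>is. length is \<le> k \<longrightarrow> (\<exists>w. has_weak_deriv \<Omega> is v w))"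

text \<open>The norm uses all iterated partial derivatives, so that for \<open>k = 2\<close> its square is
  \<open>\<parallel>v\<parallel>\<^sup>2 + \<parallel>\<nabla>v\<parallel>\<^sup>2 + \<parallel>\<nabla>\<^sup>2v\<parallel>\<^sup>2\<close> with the Frobenius norm of the full Hessian.\<close>

definition Hk_norm ::
    "nat \<Rightarrow> (real ^ 'm::finite) set \<Rightarrow> (real ^ 'm \<Rightarrow> 'b::euclidean_space) \<Rightarrow> real" where
  "Hk_norm k \<Omega> v = sqrt (\<Sum>is\<in>{is. length is \<le> k}. (L2_norm \<Omega> (weak_deriv \<Omega> is v))\<^sup>2)"

text \<open>The Poincare inequality with constant \<open>C\<close> for the vector-valued functions of \<open>H\<^sup>1(\<Omega>)\<close> that are
  continuous up to the boundary and vanish there; \<open>G\<close> is the weak gradient of \<open>v\<close>.\<close>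

definition poincare_constant :: "'b::euclidean_space itself \<Rightarrow> (real ^ 'm::finite) set \<Rightarrow> real \<Rightarrow> bool" where
  "poincare_constant _ \<Omega> C \<longleftrightarrow>
     (\<forall>(v :: real ^ 'm \<Rightarrow> 'b) G.
        (\<forall>i. has_weak_deriv \<Omega> [i] v (G i)) \<and>
        continuous_on (closure \<Omega>) v \<and> (\<forall>x\<in>frontier \<Omega>. v x = 0) \<longrightarrow>
        C * (\<integral>x. (norm (v x))\<^sup>2 \<partial>lebesgue_on \<Omega>)
          \<le> (\<integral>x. (\<Sum>i\<in>UNIV. (norm (G i x))\<^sup>2) \<partial>lebesgue_on \<Omega>))"

text \<open>\<open>C\<close> is admissible in \<open>\<parallel>v\<parallel>\<^sub>L\<^sub>\<infinity> \<le> C \<parallel>v\<parallel>\<^sup>1\<^sup>/\<^sup>4 \<parallel>v\<parallel>\<^sub>H\<^sub>2\<^sup>3\<^sup>/\<^sup>4\<close> for all vector-valued functions of \<open>H\<^sup>2(\<Omega>)\<close>.\<close>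

definition interpolation_constant ::
    "'b::euclidean_space itself \<Rightarrow> (real ^ 'm::finite) set \<Rightarrow> real \<Rightarrow> bool" where
  "interpolation_constant _ \<Omega> C \<longleftrightarrow>
     (\<forall>v :: real ^ 'm \<Rightarrow> 'b. in_Hk 2 \<Omega> v \<longrightarrow>
        Linf_norm \<Omega> v
          \<le> ereal (C * L2_norm \<Omega> v powr (1 / 4) * Hk_norm 2 \<Omega> v powr (3 / 4)))"

section \<open>The Dirichlet problem\<close>

text \<open>Classical solutions of \<open>u\<^sub>t = D(t) \<Delta>u + F(u,x,t)\<close> in \<open>\<Omega>\<close>, \<open>u = 0\<close> on the boundary,
  \<open>u(\<cdot>,0) = u\<^sub>0\<close>, written as \<open>u t x\<close>: continuous on the closed cylinder, with the derivatives in the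
  equation continuous for \<open>t > 0\<close>. The equation is not imposed at \<open>t = 0\<close>, where the
  initial condition is attained continuously.\<close>

definition classical_solution ::
    "(real ^ 'm::finite) set \<Rightarrow> (real \<Rightarrow> real ^ 'n::finite ^ 'n) \<Rightarrow>
     (real ^ 'n \<Rightarrow> real ^ 'm \<Rightarrow> real \<Rightarrow> real ^ 'n) \<Rightarrow>
     (real ^ 'm \<Rightarrow> real ^ 'n) \<Rightarrow> (real \<Rightarrow> real ^ 'm \<Rightarrow> real ^ 'n) \<Rightarrow> bool" where
  "classical_solution \<Omega> D F u\<^sub>0 u \<longleftrightarrow>
     continuous_on ({0..} \<times> closure \<Omega>) (\<lambda>(t, x). u t x) \<and>
     (\<forall>t>0. Ck_on 2 (u t) \<Omega>) \<and>
     (\<forall>i. continuous_on ({0<..} \<times> \<Omega>) (\<lambda>(t, x). partial_deriv i (u t) x)) \<and>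
     (\<forall>i j. continuous_on ({0<..} \<times> \<Omega>) (\<lambda>(t, x). partial_derivs [i, j] (u t) x)) \<and>
     (\<forall>t>0. \<forall>x\<in>\<Omega>. (\<lambda>s. u s x) differentiable (at t)) \<and>
     continuous_on ({0<..} \<times> \<Omega>) (\<lambda>(t, x). vector_derivative (\<lambda>s. u s x) (at t)) \<and>
     (\<forall>t>0. \<forall>x\<in>\<Omega>. vector_derivative (\<lambda>s. u s x) (at t)
                    = D t *v laplacian (u t) x + F (u t x) x t) \<and>
     (\<forall>t\<ge>0. \<forall>x\<in>frontier \<Omega>. u t x = 0) \<and>
     (\<forall>x\<in>closure \<Omega>. u 0 x = u\<^sub>0 x)"

end

theory Submission
  imports Defs
begin

text \<open>The energy \<open>g\<^sup>2 / 2 = \<parallel>u\<parallel>\<^sup>2 / 2\<close> formally satisfies \<open>g g' \<le> - \<sigma> g\<^sup>2 + \<alpha> g\<^sup>q\<^sup>+\<^sup>1\<close> (integration by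
  parts, Poincare inequality, interpolation), and \<open>1 / \<mu>\<close> is a supersolution of \<open>w' = - \<sigma> w + \<alpha> w\<^sup>q\<close>
  with the same initial value, so that \<open>g \<le> 1 / \<mu>\<close>. The derivatives of a classical solution are not
  controlled up to the boundary; therefore every component of \<open>u\<close> is replaced by \<open>\<theta>(u\<^sub>l)\<close>, where \<open>\<theta>\<close> is
  \<open>C\<^sup>1\<close>, vanishes on \<open>(-\<epsilon>, \<epsilon>)\<close>, satisfies \<open>0 \<le> \<theta>' \<le> 1\<close> and differs from the identity by at most \<open>2 \<epsilon>\<close>.
  As \<open>u\<close> is continuous up to the boundary and zero there, \<open>\<theta>(u\<^sub>l)\<close> vanishes near the boundary, and
  testing the equation with it yields
  \<open>d/dt \<Sum>\<^sub>l \<integral>\<Theta>(u\<^sub>l) = - \<Sum>\<^sub>l D\<^sub>l\<^sub>l \<integral>\<theta>'(u\<^sub>l)\<bar>\<nabla>u\<^sub>l\<bar>\<^sup>2 + \<integral>\<theta>(u)\<bullet>F\<close>, where \<open>\<Theta>' = \<theta>\<close>. The inequality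
  \<open>\<theta>'\<^sup>2 \<le> \<theta>'\<close> makes the Poincare inequality for \<open>\<theta>(u)\<close> applicable. All errors are \<open>O(\<epsilon>)\<close> uniformly on
  bounded time intervals.\<close>

section \<open>Truncation and integration of derivatives\<close>

text \<open>At \<open>0\<close> the condition \<open>G' 0 = 0\<close> makes the constant branch and
  \<open>G\<close> match to first order. The increment of the glued function is controlled there by
  that of \<open>G\<close>, because \<open>\<bar>max 0 y\<bar> \<le> \<bar>y\<bar>\<close>.\<close>

lemma has_real_derivative_max_zero:
  fixes G :: "real \<Rightarrow> real"
  assumes G: "\<And>x. x \<ge> 0 \<Longrightarrow> (G has_real_derivative G' x) (at x)" and "G' 0 = 0"
  shows "((\<lambda>y. G (max 0 y)) has_real_derivative G' (max 0 y)) (at y)"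
proof -
  consider "y > 0" | "y < 0" | "y = 0" by linarith
  then show ?thesis
  proof cases
    case 1
    have "((\<lambda>y. G (max 0 y)) has_real_derivative G' y) (at y)"
      by (rule has_field_derivative_transform_within_open[OF G, of _ "{0<..}"]) (use 1 in auto)
    then show ?thesis using 1 by simp
  next
    case 2
    have "((\<lambda>y. G (max 0 y)) has_real_derivative 0) (at y)"
      by (rule has_field_derivative_transform_within_open[of "\<lambda>_. G 0" _ _ "{..<0}"])
         (use 2 in \<open>auto intro!: derivative_eq_intros\<close>)
    then show ?thesis using 2 assms(2) by (simp add: max_def)
  next
    case 3
    have "(G has_derivative (\<lambda>_. 0)) (at 0)"
      using G[of 0] assms(2) by (simp add: has_field_derivative_def lambda_zero)
    then have G0: "\<exists>d>0. \<forall>y. norm (y - 0) < d \<longrightarrow> norm (G y - G 0 - 0) \<le> e * norm (y - 0)"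
      if "e > 0" for e using that unfolding has_derivative_at_alt by blast
    have "((\<lambda>y. G (max 0 y)) has_derivative (\<lambda>_. 0)) (at 0)"
      unfolding has_derivative_at_alt
    proof (intro conjI allI impI)
      fix e :: real assume "e > 0"
      from G0[OF this] obtain d where d: "d > 0"
        "\<And>y. norm (y - 0) < d \<Longrightarrow> norm (G y - G 0 - 0) \<le> e * norm (y - 0)" by blast
      show "\<exists>d>0. \<forall>y. norm (y - 0) < d \<longrightarrow>
          norm (G (max 0 y) - G (max 0 0) - 0) \<le> e * norm (y - 0)"
      proof (intro exI[of _ d] conjI allI impI d(1))
        fix y :: real assume "norm (y - 0) < d"
        then have "norm (G (max 0 y) - G 0 - 0) \<le> e * norm (max 0 y - 0)"
          by (intro d(2)) auto
        also have "\<dots> \<le> e * norm (y - 0)" using \<open>e > 0\<close> by (intro mult_left_mono) auto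
        finally show "norm (G (max 0 y) - G (max 0 0) - 0) \<le> e * norm (y - 0)" by simp
      qed
    qed simp
    then show ?thesis using 3 assms(2) by (simp add: has_field_derivative_def lambda_zero)
  qed
qed

text \<open>Away from \<open>[-\<epsilon>, \<epsilon>]\<close> the truncation is \<open>\<theta> r = sgn r (\<bar>r\<bar> - \<epsilon>)\<^sup>2 / \<bar>r\<bar>\<close>.\<close>

lemma smooth_truncation:
  fixes \<epsilon> :: real
  assumes \<epsilon>: "\<epsilon> > 0"
  obtains \<Theta> \<theta> \<theta>' :: "real \<Rightarrow> real" where
    "\<And>r. (\<Theta> has_real_derivative \<theta> r) (at r)" "\<And>r. (\<theta> has_real_derivative \<theta>' r) (at r)"
    "continuous_on UNIV \<theta>'" "\<And>r. 0 \<le> \<theta>' r" "\<And>r. \<theta>' r \<le> 1"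
    "\<And>r. \<bar>r\<bar> < \<epsilon> \<Longrightarrow> \<Theta> r = 0" "\<And>r. \<bar>r\<bar> < \<epsilon> \<Longrightarrow> \<theta> r = 0" "\<And>r. \<bar>r\<bar> < \<epsilon> \<Longrightarrow> \<theta>' r = 0"
    "\<And>r. \<bar>\<theta> r - r\<bar> \<le> 2 * \<epsilon>" "\<And>r. \<bar>\<Theta> r - r\<^sup>2 / 2\<bar> \<le> 2 * \<epsilon> * \<bar>r\<bar>"
proof -
  \<comment> \<open>With \<open>x = \<bar>r\<bar> - \<epsilon>\<close> the formula
    \<open>g x\<close> becomes \<open>(\<bar>r\<bar> - \<epsilon>)^2 / \<bar>r\<bar>\<close>.
    \<open>G\<close> is its antiderivative with \<open>G 0 = 0\<close>, and \<open>g'\<close> its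
    derivative. All three vanish at \<open>0\<close>, so they can be glued to zero.\<close>
  define G where "G x = x\<^sup>2 / 2 - \<epsilon> * x + \<epsilon>\<^sup>2 * ln (x + \<epsilon>) - \<epsilon>\<^sup>2 * ln \<epsilon>" for x
  define g where "g x = x\<^sup>2 / (x + \<epsilon>)" for x
  define g' where "g' x = 1 - \<epsilon>\<^sup>2 / (x + \<epsilon>)\<^sup>2" for x
  define \<Theta> where "\<Theta> r = G (max 0 (r - \<epsilon>)) + G (max 0 (- r - \<epsilon>))" for r
  define \<theta> where "\<theta> r = g (max 0 (r - \<epsilon>)) - g (max 0 (- r - \<epsilon>))" for r
  define \<theta>' where "\<theta>' r = g' (max 0 (r - \<epsilon>)) + g' (max 0 (- r - \<epsilon>))" for r
  have G: "(G has_real_derivative g x) (at x)" if "x \<ge> 0" for x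
    unfolding G_def[abs_def] g_def using that \<epsilon>
    by (auto intro!: derivative_eq_intros simp: field_simps power2_eq_square)
  have g: "(g has_real_derivative g' x) (at x)" if "x \<ge> 0" for x
    unfolding g_def[abs_def] g'_def using that \<epsilon>
    by (auto intro!: derivative_eq_intros simp: divide_simps) (auto simp: algebra_simps power2_eq_square)
  have zero: "G 0 = 0" "g 0 = 0" "g' 0 = 0" using \<epsilon> by (auto simp: G_def g_def g'_def)
  note Gm = DERIV_chain2[OF has_real_derivative_max_zero[of G g, OF G zero(2)]]
  note gm = DERIV_chain2[OF has_real_derivative_max_zero[of g g', OF g zero(3)]]
  have D1: "(\<Theta> has_real_derivative \<theta> r) (at r)" for r
    unfolding \<Theta>_def[abs_def] \<theta>_def by (auto intro!: derivative_eq_intros Gm)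
  have D2: "(\<theta> has_real_derivative \<theta>' r) (at r)" for r
    unfolding \<theta>'_def \<theta>_def[abs_def] by (auto intro!: derivative_eq_intros gm)
  have cont: "continuous_on UNIV \<theta>'"
  proof -
    have "max 0 (r - \<epsilon>) + \<epsilon> \<noteq> 0" "max 0 (- r - \<epsilon>) + \<epsilon> \<noteq> 0" for r using \<epsilon> by (auto simp: max_def)
    then show ?thesis unfolding \<theta>'_def[abs_def] g'_def by (intro continuous_intros) auto
  qed
  have g'01: "0 \<le> g' x \<and> g' x \<le> 1" if "x \<ge> 0" for x
    using that \<epsilon> by (auto simp: g'_def divide_simps power_mono)
  \<comment> \<open>The two arguments \<open>r - \<epsilon>\<close> and
    \<open>- r - \<epsilon>\<close> have a negative sum, so at most one branch is active and the sum
    \<open>\<theta>'\<close> is a single value of \<open>g'\<close>.\<close>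
  have one: "max 0 (r - \<epsilon>) = 0 \<or> max 0 (- r - \<epsilon>) = 0" for r using \<epsilon> by (auto simp: max_def)
  have b: "0 \<le> \<theta>' r" "\<theta>' r \<le> 1" for r
    using one[of r] g'01[of "max 0 (r - \<epsilon>)"] g'01[of "max 0 (- r - \<epsilon>)"]
    by (auto simp: \<theta>'_def zero)
  have z: "\<Theta> r = 0" "\<theta> r = 0" "\<theta>' r = 0" if "\<bar>r\<bar> < \<epsilon>" for r
    using that by (auto simp: \<Theta>_def \<theta>_def \<theta>'_def zero max_def abs_if split: if_splits)
  \<comment> \<open>For \<open>x = \<bar>r\<bar> - \<epsilon>\<close> this difference is
    \<open>\<bar>r\<bar> - \<bar>\<theta> r\<bar>\<close>, the distance of the truncation from the
    identity.\<close>
  have gx: "0 \<le> x + \<epsilon> - g x \<and> x + \<epsilon> - g x \<le> 2 * \<epsilon>" if "x \<ge> 0" for x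
  proof -
    have "x + \<epsilon> - g x = (2 * x * \<epsilon> + \<epsilon>\<^sup>2) / (x + \<epsilon>)"
      using that \<epsilon> by (simp add: g_def field_simps power2_eq_square)
    moreover have "0 \<le> (2 * x * \<epsilon> + \<epsilon>\<^sup>2) / (x + \<epsilon>)" using that \<epsilon> by simp
    moreover have "(2 * x * \<epsilon> + \<epsilon>\<^sup>2) / (x + \<epsilon>) \<le> 2 * \<epsilon>"
      using that \<epsilon> by (simp add: pos_divide_le_eq algebra_simps power2_eq_square)
    ultimately show ?thesis by simp
  qed
  have c1: "\<bar>\<theta> r - r\<bar> \<le> 2 * \<epsilon>" for r
  proof -
    consider "r > \<epsilon>" | "r < - \<epsilon>" | "\<bar>r\<bar> \<le> \<epsilon>" by linarith
    then show ?thesis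
    proof cases
      case 1 then show ?thesis using gx[of "r - \<epsilon>"] \<epsilon> by (auto simp: \<theta>_def zero max_def)
    next
      case 2 then show ?thesis using gx[of "- r - \<epsilon>"] \<epsilon> by (auto simp: \<theta>_def zero max_def)
    next
      case 3
      then have "max 0 (r - \<epsilon>) = 0" "max 0 (- r - \<epsilon>) = 0" by auto
      then show ?thesis using 3 by (simp add: \<theta>_def zero)
    qed
  qed
  have c2: "\<bar>\<Theta> r - r\<^sup>2 / 2\<bar> \<le> 2 * \<epsilon> * \<bar>r\<bar>" for r
  proof -
    \<comment> \<open>Mean value inequality: \<open>\<Theta> r - r^2 / 2\<close> vanishes at
      \<open>0\<close> and its derivative \<open>\<theta> r - r\<close> is bounded by
      \<open>2 * \<epsilon>\<close>.\<close>
    have "norm ((\<Theta> r - r\<^sup>2 / 2) - (\<Theta> 0 - 0\<^sup>2 / 2)) \<le> 2 * \<epsilon> * norm (r - 0)"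
    proof (rule field_differentiable_bound[of UNIV _ "\<lambda>r. \<theta> r - r"])
      show "((\<lambda>r. \<Theta> r - r\<^sup>2 / 2) has_real_derivative \<theta> z - z) (at z within UNIV)" for z
        by (auto intro!: derivative_eq_intros D1)
    qed (use c1 in auto)
    then show ?thesis using z(1)[of 0] \<epsilon> by simp
  qed
  show thesis by (rule that[of \<Theta> \<theta> \<theta>']) (use D1 D2 cont b z c1 c2 in auto)
qed

text \<open>By translation invariance \<open>s \<mapsto> \<integral>f(x + s e) dx\<close> is constant; its derivative at \<open>0\<close> is \<open>\<integral>f'\<close>.\<close>

lemma integral_directional_derivative_zero:
  fixes f f' :: "'a::euclidean_space \<Rightarrow> 'b::banach"
  assumes f: "continuous_on UNIV f" and f': "continuous_on UNIV f'"
    and D: "\<And>x. ((\<lambda>s. f (x + s *\<^sub>R e)) has_vector_derivative f' x) (at 0)"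
    and supp: "\<And>x. x \<notin> cbox a b \<Longrightarrow> f x = 0"
  shows "integral (cbox a b) f' = 0"
proof -
  \<comment> \<open>Enlarging the box by the componentwise absolute value of \<open>e\<close> gives
    one fixed domain of integration that contains the shifted supports for all
    \<open>\<bar>s\<bar> \<le> 1\<close>.\<close>
  define N where "N = (\<Sum>i\<in>Basis. \<bar>e \<bullet> i\<bar> *\<^sub>R i)"
  define a' b' where "a' = a - N" and "b' = b + N"
  have N: "N \<bullet> i = \<bar>e \<bullet> i\<bar>" if "i \<in> Basis" for i
    using that by (simp add: N_def)
  have sub: "cbox (a - s *\<^sub>R e) (b - s *\<^sub>R e) \<subseteq> cbox a' b'" if "\<bar>s\<bar> \<le> 1" for s
  proof
    fix x assume x: "x \<in> cbox (a - s *\<^sub>R e) (b - s *\<^sub>R e)"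
    show "x \<in> cbox a' b'"
      unfolding mem_box
    proof
      fix i :: 'a assume i: "i \<in> Basis"
      have "\<bar>s * (e \<bullet> i)\<bar> \<le> \<bar>e \<bullet> i\<bar>"
        using mult_right_mono[OF that, of "\<bar>e \<bullet> i\<bar>"] by (simp add: abs_mult)
      moreover have "a \<bullet> i - s * (e \<bullet> i) \<le> x \<bullet> i" "x \<bullet> i \<le> b \<bullet> i - s * (e \<bullet> i)"
        using x i by (auto simp: mem_box inner_simps)
      ultimately show "a' \<bullet> i \<le> x \<bullet> i \<and> x \<bullet> i \<le> b' \<bullet> i"
        using N[OF i] by (auto simp: a'_def b'_def inner_simps)
    qed
  qed
  \<comment> \<open>The complement of the box is open, so \<open>f\<close> is zero on a short piece
    of the line through \<open>x\<close>. Hence integrating \<open>f'\<close> over the larger box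
    changes nothing.\<close>
  have f'0: "f' x = 0" if "x \<notin> cbox a b" for x
  proof -
    have op: "open ((\<lambda>s. x + s *\<^sub>R e) -` (- cbox a b))"
      by (intro open_vimage continuous_intros) auto
    have "((\<lambda>s. f (x + s *\<^sub>R e)) has_vector_derivative 0) (at 0)"
      by (rule has_vector_derivative_transform_within_open[OF _ op, of "\<lambda>_. 0"])
         (use that supp in auto)
    then show ?thesis using D vector_derivative_unique_at by blast
  qed
  have const: "integral (cbox a' b') (\<lambda>x. f (x + s *\<^sub>R e)) = integral (cbox a b) f" if "\<bar>s\<bar> \<le> 1" for s
  proof -
    have "(\<lambda>x. f (x + s *\<^sub>R e)) = (\<lambda>x. if x \<in> cbox (a - s *\<^sub>R e) (b - s *\<^sub>R e) then f (x + s *\<^sub>R e) else 0)"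
    proof
      fix x
      have "x + s *\<^sub>R e \<in> cbox a b" if "f (x + s *\<^sub>R e) \<noteq> 0" using supp that by blast
      then show "f (x + s *\<^sub>R e) = (if x \<in> cbox (a - s *\<^sub>R e) (b - s *\<^sub>R e) then f (x + s *\<^sub>R e) else 0)"
        by (auto simp: mem_box inner_simps algebra_simps)
    qed
    then have "integral (cbox a' b') (\<lambda>x. f (x + s *\<^sub>R e)) = integral (cbox a' b')
        (\<lambda>x. if x \<in> cbox (a - s *\<^sub>R e) (b - s *\<^sub>R e) then f (x + s *\<^sub>R e) else 0)"
      by (rule arg_cong)
    also have "\<dots> = integral (cbox (a - s *\<^sub>R e) (b - s *\<^sub>R e)) (\<lambda>x. f (x + s *\<^sub>R e))"
      using sub[OF that] by (simp add: Henstock_Kurzweil_Integration.integral_restrict_Int Int_absorb2)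
    finally show ?thesis by (simp add: integral_shift_cbox)
  qed
  have "((\<lambda>s. integral (cbox a' b') (\<lambda>x. f (x + s *\<^sub>R e))) has_vector_derivative
      integral (cbox a' b') (\<lambda>x. f' (x + 0 *\<^sub>R e))) (at 0 within UNIV)"
  proof (rule leibniz_rule_vector_derivative)
    show "((\<lambda>s. f (x + s *\<^sub>R e)) has_vector_derivative f' (x + s *\<^sub>R e)) (at s within UNIV)" for s x
    proof -
      \<comment> \<open>The derivative is assumed only at parameter \<open>0\<close>; moving the
        base point to \<open>x + s *\<^sub>R e\<close> gives it at every \<open>s\<close>.\<close>
      have "((\<lambda>r. f ((x + s *\<^sub>R e) + r *\<^sub>R e)) \<circ> (\<lambda>r. r - s) has_vector_derivative 1 *\<^sub>R f' (x + s *\<^sub>R e)) (at s)"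
        by (rule vector_diff_chain_at) (auto intro!: derivative_eq_intros D)
      then show ?thesis by (simp add: o_def algebra_simps)
    qed
    show "(\<lambda>x. f (x + s *\<^sub>R e)) integrable_on cbox a' b'" for s
      by (intro integrable_continuous continuous_on_compose2[OF f] continuous_intros) auto
    show "continuous_on (UNIV \<times> cbox a' b') (\<lambda>(s, x). f' (x + s *\<^sub>R e))"
      unfolding split_beta by (intro continuous_on_compose2[OF f'] continuous_intros) auto
  qed auto
  moreover have "((\<lambda>s. integral (cbox a' b') (\<lambda>x. f (x + s *\<^sub>R e))) has_vector_derivative 0) (at 0)"
    by (rule has_vector_derivative_transform_within_open[of "\<lambda>_. integral (cbox a b) f" _ _ "{-1<..<1}"])
       (auto simp: const)
  ultimately have "integral (cbox a' b') f' = 0"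
    using vector_derivative_unique_at by fastforce
  moreover have "integral (cbox a' b') f' = integral (cbox a' b') (\<lambda>x. if x \<in> cbox a b then f' x else 0)"
    by (rule integral_cong) (use f'0 in auto)
  ultimately show ?thesis
    using sub[of 0] by (simp add: Henstock_Kurzweil_Integration.integral_restrict_Int Int_absorb2)
qed

section \<open>Functions vanishing near the boundary\<close>

text \<open>Extension by zero: integrals over \<Omega> become integrals over a box, where
  translation and the Leibniz rule are applied.\<close>

definition zext :: "'a set \<Rightarrow> ('a \<Rightarrow> 'b::zero) \<Rightarrow> 'a \<Rightarrow> 'b" where
  "zext \<Omega> f x = (if x \<in> \<Omega> then f x else 0)"

text \<open>\<open>X\<close> is the ambient set: the whole space, or \<open>T \<times> UNIV\<close> for time-dependent functions on \<open>T \<times> \<Omega>\<close>.\<close>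

definition vanishes_near_boundary ::
    "'a::topological_space set \<Rightarrow> 'a set \<Rightarrow> ('a \<Rightarrow> 'b::zero) \<Rightarrow> bool" where
  "vanishes_near_boundary X \<Omega> f \<longleftrightarrow>
     (\<forall>x\<in>X - \<Omega>. \<exists>S. open S \<and> x \<in> S \<and> (\<forall>y\<in>S \<inter> \<Omega>. f y = 0))"

lemma vanishes_near_boundary_mono:
  assumes "vanishes_near_boundary X \<Omega> f" "\<And>x. x \<in> \<Omega> \<Longrightarrow> f x = 0 \<Longrightarrow> g x = 0"
  shows "vanishes_near_boundary X \<Omega> g"
  using assms unfolding vanishes_near_boundary_def by (metis Int_iff)

lemma vanishes_near_boundary_slice:
  assumes "vanishes_near_boundary (T \<times> UNIV) (T \<times> \<Omega>) f" "t \<in> T"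
  shows "vanishes_near_boundary UNIV \<Omega> (\<lambda>x. f (t, x))"
  unfolding vanishes_near_boundary_def
proof
  fix x assume "x \<in> UNIV - \<Omega>"
  then have "(t, x) \<in> T \<times> UNIV - T \<times> \<Omega>" using assms(2) by simp
  with assms(1) obtain S where S: "open S" "(t, x) \<in> S" "\<forall>y\<in>S \<inter> (T \<times> \<Omega>). f y = 0"
    unfolding vanishes_near_boundary_def by meson
  have "open (Pair t -` S)" by (intro open_vimage S continuous_intros)
  with S assms(2) show "\<exists>S. open S \<and> x \<in> S \<and> (\<forall>y\<in>S \<inter> \<Omega>. f (t, y) = 0)"
    by (intro exI[of _ "Pair t -` S"]) auto
qed

text \<open>At a boundary point \<open>v\<close> is zero, so by joint continuity
  \<open>norm v < \<epsilon>\<close> on a neighbourhood, relative to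
  \<open>T \<times> closure \<Omega>\<close>, and \<open>f\<close> vanishes there. A point outside
  the closure has a neighbourhood disjoint from the domain.\<close>

lemma vanishes_near_boundaryI:
  fixes v :: "'a::metric_space \<times> 'b::metric_space \<Rightarrow> 'c::real_normed_vector"
  assumes \<Omega>: "open \<Omega>" and v: "continuous_on (T \<times> closure \<Omega>) v"
    and v0: "\<And>t x. t \<in> T \<Longrightarrow> x \<in> frontier \<Omega> \<Longrightarrow> v (t, x) = 0"
    and \<epsilon>: "\<epsilon> > 0" and f: "\<And>t x. t \<in> T \<Longrightarrow> x \<in> \<Omega> \<Longrightarrow> norm (v (t, x)) < \<epsilon> \<Longrightarrow> f (t, x) = 0"
  shows "vanishes_near_boundary (T \<times> UNIV) (T \<times> \<Omega>) f"
  unfolding vanishes_near_boundary_def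
proof
  fix y assume "y \<in> T \<times> (UNIV :: 'b set) - T \<times> \<Omega>"
  then obtain t x where y: "y = (t, x)" and t: "t \<in> T" and x: "x \<notin> \<Omega>" by auto
  have "\<exists>S. open S \<and> (t, x) \<in> S \<and> (\<forall>y\<in>S \<inter> T \<times> \<Omega>. f y = 0)"
  proof (cases "x \<in> closure \<Omega>")
    case True
    then have "v (t, x) = 0" using x t v0 \<Omega> by (simp add: frontier_def interior_open)
    moreover obtain \<delta> where \<delta>: "\<delta> > 0"
      "\<And>y. y \<in> T \<times> closure \<Omega> \<Longrightarrow> dist y (t, x) < \<delta> \<Longrightarrow> dist (v y) (v (t, x)) < \<epsilon>"
      using v[unfolded continuous_on_iff, rule_format, OF _ \<epsilon>, of "(t, x)"] True t by auto
    ultimately have "f y = 0" if "y \<in> ball (t, x) \<delta> \<inter> T \<times> \<Omega>" for y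
      using that f[of "fst y" "snd y"] \<delta>(2)[of y] closure_subset[of \<Omega>]
      by (auto simp: dist_commute)
    then show ?thesis using \<delta>(1) by (intro exI[of _ "ball (t, x) \<delta>"]) auto
  next
    case False
    then show ?thesis using closure_subset[of \<Omega>]
      by (intro exI[of _ "UNIV \<times> - closure \<Omega>"]) (auto intro!: open_Times)
  qed
  then show "\<exists>S. open S \<and> y \<in> S \<and> (\<forall>y\<in>S \<inter> T \<times> \<Omega>. f y = 0)" by (simp add: y)
qed

lemma zext_locally_zero:
  assumes "vanishes_near_boundary X \<Omega> f" "x \<in> X" "x \<notin> \<Omega>"
  obtains S where "open S" "x \<in> S" "\<And>y. y \<in> S \<Longrightarrow> zext \<Omega> f y = 0"
  using assms unfolding vanishes_near_boundary_def zext_def by (metis DiffI IntI)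

text \<open>Near a point of the open set \<Omega> the extension is \<open>f\<close>; near any other
  point of \<open>X\<close> it is identically zero.\<close>

lemma continuous_on_zext:
  fixes f :: "'a::t2_space \<Rightarrow> 'b::real_normed_vector"
  assumes \<Omega>: "open \<Omega>" and f: "continuous_on \<Omega> f" and v: "vanishes_near_boundary X \<Omega> f"
  shows "continuous_on X (zext \<Omega> f)"
proof (rule continuous_at_imp_continuous_on, rule ballI)
  fix x assume x: "x \<in> X"
  show "isCont (zext \<Omega> f) x"
  proof (cases "x \<in> \<Omega>")
    case True
    have "continuous_on \<Omega> (zext \<Omega> f)"
      using f by (rule continuous_on_eq) (simp add: zext_def)
    then show ?thesis using True \<Omega> continuous_on_eq_continuous_at by blast
  next
    case False
    from zext_locally_zero[OF v x this] obtain S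
      where S: "open S" "x \<in> S" "\<And>y. y \<in> S \<Longrightarrow> zext \<Omega> f y = 0" by blast
    then have "continuous_on S (zext \<Omega> f)" using continuous_on_const[of S 0] continuous_on_eq by metis
    then show ?thesis using S continuous_on_eq_continuous_at by blast
  qed
qed

text \<open>Bridge from the Bochner integral over \<Omega> to the Henstock-Kurzweil integral over a
  box: the zero extension is continuous, hence absolutely integrable there.\<close>

lemma integral_zext:
  fixes f :: "'a::euclidean_space \<Rightarrow> 'b::euclidean_space"
  assumes \<Omega>: "open \<Omega>" "\<Omega> \<subseteq> cbox a b" and f: "continuous_on UNIV (zext \<Omega> f)"
  shows "integrable (lebesgue_on \<Omega>) f"
    and "(\<integral>x. f x \<partial>lebesgue_on \<Omega>) = integral (cbox a b) (zext \<Omega> f)"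
proof -
  have "zext \<Omega> f absolutely_integrable_on cbox a b"
    by (rule absolutely_integrable_continuous) (use f continuous_on_subset in blast)
  then have "zext \<Omega> f absolutely_integrable_on \<Omega>"
    by (rule set_integrable_subset) (use \<Omega> in auto)
  then have "integrable (lebesgue_on \<Omega>) (zext \<Omega> f)"
    using \<Omega> by (simp add: absolutely_integrable_imp_integrable)
  then show i: "integrable (lebesgue_on \<Omega>) f"
    by (rule Bochner_Integration.integrable_cong[THEN iffD1, rotated -1]) (auto simp: zext_def)
  have "(\<integral>x. f x \<partial>lebesgue_on \<Omega>) = integral \<Omega> f"
    by (rule lebesgue_integral_eq_integral[OF i]) (use \<Omega> in auto)
  also have "\<dots> = integral (cbox a b) (\<lambda>x. if x \<in> \<Omega> then f x else 0)"
    using \<Omega>(2) by (simp add: Henstock_Kurzweil_Integration.integral_restrict_Int Int_absorb2)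
  finally show "(\<integral>x. f x \<partial>lebesgue_on \<Omega>) = integral (cbox a b) (zext \<Omega> f)"
    by (simp add: zext_def[abs_def])
qed

lemma integrable_vanishing:
  fixes f :: "'a::euclidean_space \<Rightarrow> 'b::euclidean_space"
  assumes "open \<Omega>" "bounded \<Omega>" "continuous_on \<Omega> f" "vanishes_near_boundary UNIV \<Omega> f"
  shows "integrable (lebesgue_on \<Omega>) f"
  using integral_zext(1)[of \<Omega>] continuous_on_zext assms bounded_subset_cbox_symmetric by metis

text \<open>Source of all integrations by parts below, with no boundary term. The zero extension of
  \<open>f\<close> has the zero extension of \<open>f'\<close> as directional derivative: outside
  \<Omega> both are zero because \<open>f\<close> vanishes nearby.\<close>

lemma integral_directional_derivative_zero_on:
  fixes f f' :: "'a::euclidean_space \<Rightarrow> 'b::euclidean_space"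
  assumes \<Omega>: "open \<Omega>" "bounded \<Omega>" and f: "continuous_on \<Omega> f" "vanishes_near_boundary UNIV \<Omega> f"
    and f': "continuous_on \<Omega> f'" "vanishes_near_boundary UNIV \<Omega> f'"
    and D: "\<And>x. x \<in> \<Omega> \<Longrightarrow> ((\<lambda>s. f (x + s *\<^sub>R e)) has_vector_derivative f' x) (at 0)"
  shows "(\<integral>x. f' x \<partial>lebesgue_on \<Omega>) = 0"
proof -
  obtain a where a: "\<Omega> \<subseteq> cbox (- a) a" using bounded_subset_cbox_symmetric[OF \<Omega>(2)] by blast
  note cont = continuous_on_zext[OF \<Omega>(1) f] continuous_on_zext[OF \<Omega>(1) f']
  have "integral (cbox (- a) a) (zext \<Omega> f') = 0"
  proof (rule integral_directional_derivative_zero[OF cont])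
    fix x
    show "((\<lambda>s. zext \<Omega> f (x + s *\<^sub>R e)) has_vector_derivative zext \<Omega> f' x) (at 0)"
    proof (cases "x \<in> \<Omega>")
      case True
      have "open ((\<lambda>s. x + s *\<^sub>R e) -` \<Omega>)" by (intro open_vimage continuous_intros \<Omega>)
      from has_vector_derivative_transform_within_open[OF D[OF True] this] True
      show ?thesis by (auto simp: zext_def)
    next
      case False
      from zext_locally_zero[OF f(2) _ this] obtain S
        where S: "open S" "x \<in> S" "\<And>y. y \<in> S \<Longrightarrow> zext \<Omega> f y = 0" by blast
      have op: "open ((\<lambda>s. x + s *\<^sub>R e) -` S)" by (intro open_vimage continuous_intros S)
      have "((\<lambda>s. zext \<Omega> f (x + s *\<^sub>R e)) has_vector_derivative 0) (at 0)"
        by (rule has_vector_derivative_transform_within_open[of "\<lambda>_. 0", OF _ op]) (use S in auto)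
      then show ?thesis using False by (simp add: zext_def)
    qed
  next
    fix x assume "x \<notin> cbox (- a) a"
    then show "zext \<Omega> f x = 0" using a by (auto simp: zext_def)
  qed
  then show ?thesis using integral_zext(2)[OF \<Omega>(1) a cont(2)] by simp
qed

text \<open>The neighbourhoods in the vanishing condition are taken in time and space together, so
  the zero extension of \<open>f'\<close> is jointly continuous on \<open>T\<close> times a box and
  the Leibniz rule applies.\<close>

lemma has_vector_derivative_integral_vanishing:
  fixes f f' :: "real \<times> 'a::euclidean_space \<Rightarrow> 'b::euclidean_space"
  assumes \<Omega>: "open \<Omega>" "bounded \<Omega>" and T: "open T" "convex T" "t \<in> T"
    and f: "continuous_on (T \<times> \<Omega>) f" "vanishes_near_boundary (T \<times> UNIV) (T \<times> \<Omega>) f"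
    and f': "continuous_on (T \<times> \<Omega>) f'" "vanishes_near_boundary (T \<times> UNIV) (T \<times> \<Omega>) f'"
    and D: "\<And>s x. s \<in> T \<Longrightarrow> x \<in> \<Omega> \<Longrightarrow> ((\<lambda>s. f (s, x)) has_vector_derivative f' (s, x)) (at s)"
  shows "((\<lambda>s. \<integral>x. f (s, x) \<partial>lebesgue_on \<Omega>) has_vector_derivative
           (\<integral>x. f' (t, x) \<partial>lebesgue_on \<Omega>)) (at t)"
proof -
  obtain a where a: "\<Omega> \<subseteq> cbox (- a) a" using bounded_subset_cbox_symmetric[OF \<Omega>(2)] by blast
  have op: "open (T \<times> \<Omega>)" using T \<Omega> by (intro open_Times)
  have slice: "continuous_on UNIV (zext \<Omega> (\<lambda>x. g (s, x)))"
    if "continuous_on (T \<times> \<Omega>) g" "vanishes_near_boundary (T \<times> UNIV) (T \<times> \<Omega>) g" "s \<in> T"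
    for g :: "real \<times> 'a \<Rightarrow> 'b" and s
  proof (rule continuous_on_zext[OF \<Omega>(1)])
    show "continuous_on \<Omega> (\<lambda>x. g (s, x))"
      by (rule continuous_on_compose2[OF that(1)]) (use that in \<open>auto intro!: continuous_intros\<close>)
  qed (rule vanishes_near_boundary_slice[OF that(2,3)])
  have "((\<lambda>s. integral (cbox (- a) a) (zext \<Omega> (\<lambda>x. f (s, x)))) has_vector_derivative
      integral (cbox (- a) a) (zext \<Omega> (\<lambda>x. f' (t, x)))) (at t within T)"
  proof (rule leibniz_rule_vector_derivative)
    fix s x assume "s \<in> T"
    show "((\<lambda>s. zext \<Omega> (\<lambda>x. f (s, x)) x) has_vector_derivative zext \<Omega> (\<lambda>x. f' (s, x)) x) (at s within T)"
      using D[OF \<open>s \<in> T\<close>, of x] by (auto simp: zext_def intro: has_vector_derivative_at_within)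
  next
    fix s assume "s \<in> T"
    show "zext \<Omega> (\<lambda>x. f (s, x)) integrable_on cbox (- a) a"
      by (rule integrable_continuous) (use slice[OF f \<open>s \<in> T\<close>] continuous_on_subset in blast)
  next
    have "continuous_on (T \<times> UNIV) (zext (T \<times> \<Omega>) f')" by (rule continuous_on_zext[OF op f'])
    then have "continuous_on (T \<times> cbox (- a) a) (zext (T \<times> \<Omega>) f')"
      by (rule continuous_on_subset) auto
    then show "continuous_on (T \<times> cbox (- a) a) (\<lambda>(s, x). zext \<Omega> (\<lambda>x. f' (s, x)) x)"
      by (rule continuous_on_eq) (auto simp: zext_def split: if_splits)
  qed (use T in auto)
  then have "((\<lambda>s. integral (cbox (- a) a) (zext \<Omega> (\<lambda>x. f (s, x)))) has_vector_derivative
      (\<integral>x. f' (t, x) \<partial>lebesgue_on \<Omega>)) (at t)"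
    using integral_zext(2)[OF \<Omega>(1) a slice[OF f' T(3)]] at_within_open[OF T(3,1)] by simp
  then show ?thesis
    by (rule has_vector_derivative_transform_within_open[OF _ T(1,3)])
       (use integral_zext(2)[OF \<Omega>(1) a slice[OF f]] in simp)
qed

text \<open>Openness of \<open>T\<close> makes \<open>T \<times> \<Omega>\<close> open, so the zero
  extension is jointly continuous; its integral over a box then depends continuously on the
  parameter.\<close>

lemma continuous_on_integral_vanishing:
  fixes f :: "'p::t2_space \<times> 'a::euclidean_space \<Rightarrow> 'b::euclidean_space"
  assumes \<Omega>: "open \<Omega>" "bounded \<Omega>" and T: "open T"
    and f: "continuous_on (T \<times> \<Omega>) f" "vanishes_near_boundary (T \<times> UNIV) (T \<times> \<Omega>) f"
  shows "continuous_on T (\<lambda>s. \<integral>x. f (s, x) \<partial>lebesgue_on \<Omega>)"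
proof -
  obtain a where a: "\<Omega> \<subseteq> cbox (- a) a" using bounded_subset_cbox_symmetric[OF \<Omega>(2)] by blast
  have z: "continuous_on (T \<times> UNIV) (zext (T \<times> \<Omega>) f)"
    by (rule continuous_on_zext[OF open_Times[OF T \<Omega>(1)] f])
  have "continuous_on (T \<times> cbox (- a) a) (\<lambda>(s, x). zext (T \<times> \<Omega>) f (s, x))"
    using continuous_on_subset[OF z, of "T \<times> cbox (- a) a"] by auto
  then have "continuous_on T (\<lambda>s. integral (cbox (- a) a) (\<lambda>x. zext (T \<times> \<Omega>) f (s, x)))"
    by (rule integral_continuous_on_param)
  then show ?thesis
  proof (rule continuous_on_eq)
    fix s assume s: "s \<in> T"
    then have eq: "zext \<Omega> (\<lambda>x. f (s, x)) = (\<lambda>x. zext (T \<times> \<Omega>) f (s, x))"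
      by (auto simp: zext_def)
    have "continuous_on UNIV (\<lambda>x. zext (T \<times> \<Omega>) f (s, x))"
      by (rule continuous_on_compose2[OF z]) (use s in \<open>auto intro!: continuous_intros\<close>)
    then show "integral (cbox (- a) a) (\<lambda>x. zext (T \<times> \<Omega>) f (s, x)) = (\<integral>x. f (s, x) \<partial>lebesgue_on \<Omega>)"
      using integral_zext(2)[OF \<Omega>(1) a, of "\<lambda>x. f (s, x)"] by (simp add: eq)
  qed
qed

section \<open>The truncated energy identity\<close>

lemma has_vector_derivative_partial_deriv:
  fixes f :: "real ^ 'm::finite \<Rightarrow> 'b::real_normed_vector"
  assumes "f differentiable (at x)"
  shows "((\<lambda>s. f (x + s *\<^sub>R axis j 1)) has_vector_derivative partial_deriv j f x) (at 0)"
proof -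
  have f: "(f has_derivative frechet_derivative f (at x)) (at (x + 0 *\<^sub>R axis j 1))"
    using assms by (simp add: frechet_derivative_works)
  have "((\<lambda>s. x + s *\<^sub>R axis j 1) has_vector_derivative axis j 1) (at (0 :: real))"
    by (auto intro!: derivative_eq_intros)
  from vector_derivative_diff_chain_within[OF this, of f] f show ?thesis
    by (auto simp: o_def partial_deriv_def intro: has_derivative_at_withinI)
qed

lemma has_vector_derivative_component:
  fixes f :: "real \<Rightarrow> real ^ 'n::finite"
  assumes "(f has_vector_derivative f') F"
  shows "((\<lambda>s. f s $ l) has_vector_derivative f' $ l) F"
  using bounded_linear.has_vector_derivative[OF bounded_linear_vec_nth assms] .

section \<open>Classical solutions and their truncations\<close>

locale dirichlet_flow =
  fixes \<Omega> :: "(real ^ 'm::finite) set"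
    and D :: "real \<Rightarrow> real ^ 'n::finite ^ 'n"
    and F :: "real ^ 'n \<Rightarrow> real ^ 'm \<Rightarrow> real \<Rightarrow> real ^ 'n"
    and u\<^sub>0 :: "real ^ 'm \<Rightarrow> real ^ 'n"
    and u :: "real \<Rightarrow> real ^ 'm \<Rightarrow> real ^ 'n"
  assumes open_dom: "open \<Omega>" and bounded_dom: "bounded \<Omega>"
    and D_diag: "\<And>t i j. t > 0 \<Longrightarrow> i \<noteq> j \<Longrightarrow> D t $ i $ j = 0"
    and solution: "classical_solution \<Omega> D F u\<^sub>0 u"
begin

lemma u_cont: "continuous_on ({0..} \<times> closure \<Omega>) (\<lambda>p. u (fst p) (snd p))"
  and pd_cont: "continuous_on ({0<..} \<times> \<Omega>) (\<lambda>p. partial_deriv j (u (fst p)) (snd p))"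
  and pd2_cont: "continuous_on ({0<..} \<times> \<Omega>) (\<lambda>p. partial_deriv i (partial_deriv j (u (fst p))) (snd p))"
  and ut_cont: "continuous_on ({0<..} \<times> \<Omega>) (\<lambda>p. vector_derivative (\<lambda>s. u s (snd p)) (at (fst p)))"
  and u_frontier: "t \<ge> 0 \<Longrightarrow> x \<in> frontier \<Omega> \<Longrightarrow> u t x = 0"
  and equation: "t > 0 \<Longrightarrow> x \<in> \<Omega> \<Longrightarrow> vector_derivative (\<lambda>s. u s x) (at t) =
                  D t *v laplacian (u t) x + F (u t x) x t"
  and ut: "t > 0 \<Longrightarrow> x \<in> \<Omega> \<Longrightarrow>
             ((\<lambda>s. u s x) has_vector_derivative vector_derivative (\<lambda>s. u s x) (at t)) (at t)"
  and C2: "t > 0 \<Longrightarrow> Ck_on 2 (u t) \<Omega>"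
  using solution unfolding classical_solution_def split_beta
  by (auto simp: vector_derivative_works)

lemma pd:
  assumes "t > 0" "x \<in> \<Omega>"
  shows "((\<lambda>s. u t (x + s *\<^sub>R axis j 1)) has_vector_derivative partial_deriv j (u t) x) (at 0)"
    and "((\<lambda>s. partial_deriv j (u t) (x + s *\<^sub>R axis j 1)) has_vector_derivative
            partial_deriv j (partial_deriv j (u t)) x) (at 0)"
  using C2[OF assms(1)] assms(2)
  by (auto simp: numeral_2_eq_2 intro!: has_vector_derivative_partial_deriv)

lemma u_slice_cont: "t \<ge> 0 \<Longrightarrow> continuous_on (closure \<Omega>) (u t)"
  using continuous_on_compose2[OF u_cont continuous_on_Pair[OF continuous_on_const continuous_on_id], of t "closure \<Omega>"]
  by auto

lemma vanishing:
  assumes "\<epsilon> > 0" "T \<subseteq> {0..}" "\<And>t x. t \<in> T \<Longrightarrow> x \<in> \<Omega> \<Longrightarrow> norm (u t x) < \<epsilon> \<Longrightarrow> f (t, x) = 0"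
  shows "vanishes_near_boundary (T \<times> UNIV) (T \<times> \<Omega>) f"
proof (rule vanishes_near_boundaryI[OF open_dom])
  show "continuous_on (T \<times> closure \<Omega>) (\<lambda>p. u (fst p) (snd p))"
    by (rule continuous_on_subset[OF u_cont]) (use assms(2) in auto)
qed (use assms u_frontier in auto)

lemma vanishing_slice:
  assumes "\<epsilon> > 0" "t \<ge> 0" "\<And>x. x \<in> \<Omega> \<Longrightarrow> norm (u t x) < \<epsilon> \<Longrightarrow> f x = 0"
  shows "vanishes_near_boundary UNIV \<Omega> f"
  using vanishes_near_boundary_slice[OF vanishing[of \<epsilon> "{t}" "\<lambda>p. f (snd p)"], of t] assms by auto

end

text \<open>Everything here holds at a fixed \<epsilon>. The distance of \<theta> from the identity,
  and of \<Theta> from \<open>r^2 / 2\<close>, enters only when errors are estimated in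
  \<open>energy_inequality\<close>.\<close>

locale truncated_flow = dirichlet_flow \<Omega> D F u\<^sub>0 u
  for \<Omega> :: "(real ^ 'm::finite) set" and D :: "real \<Rightarrow> real ^ 'n::finite ^ 'n" and F u\<^sub>0 u +
  fixes \<epsilon> :: real and \<Theta> \<theta> \<theta>' :: "real \<Rightarrow> real"
  assumes \<epsilon>: "\<epsilon> > 0"
    and D\<Theta>: "\<And>r. (\<Theta> has_real_derivative \<theta> r) (at r)"
    and D\<theta>: "\<And>r. (\<theta> has_real_derivative \<theta>' r) (at r)"
    and cont_\<theta>': "continuous_on UNIV \<theta>'"
    and \<theta>'_01: "\<And>r. 0 \<le> \<theta>' r" "\<And>r. \<theta>' r \<le> 1"
    and zero: "\<And>r. \<bar>r\<bar> < \<epsilon> \<Longrightarrow> \<Theta> r = 0" "\<And>r. \<bar>r\<bar> < \<epsilon> \<Longrightarrow> \<theta> r = 0" "\<And>r. \<bar>r\<bar> < \<epsilon> \<Longrightarrow> \<theta>' r = 0"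
begin

lemma cont_\<Theta>: "continuous_on UNIV \<Theta>"
  using D\<Theta> DERIV_isCont continuous_at_imp_continuous_on by blast

lemma cont_\<theta>: "continuous_on UNIV \<theta>"
  using D\<theta> DERIV_isCont continuous_at_imp_continuous_on by blast

lemma zero_component:
  assumes "norm (v :: real ^ 'n) < \<epsilon>"
  shows "\<Theta> (v $ l) = 0" "\<theta> (v $ l) = 0" "\<theta>' (v $ l) = 0"
  using zero component_le_norm_cart[of v l] assms by auto

abbreviation v :: "real \<Rightarrow> real ^ 'm \<Rightarrow> real ^ 'n" where
  "v t x \<equiv> \<chi> l. \<theta> (u t x $ l)"

abbreviation Dv :: "'m \<Rightarrow> real \<Rightarrow> real ^ 'm \<Rightarrow> real ^ 'n" where
  "Dv j t x \<equiv> \<chi> l. \<theta>' (u t x $ l) * partial_deriv j (u t) x $ l"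

lemma slices_cont:
  assumes "t > 0"
  shows "continuous_on \<Omega> (u t)" "continuous_on \<Omega> (\<lambda>x. partial_deriv j (u t) x)"
    "continuous_on \<Omega> (\<lambda>x. partial_deriv i (partial_deriv j (u t)) x)"
    "continuous_on \<Omega> (\<lambda>x. vector_derivative (\<lambda>s. u s x) (at t))"
proof -
  have *: "continuous_on \<Omega> (\<lambda>x. f (t, x))" if "continuous_on ({0<..} \<times> \<Omega>) f"
    for f :: "real \<times> (real ^ 'm) \<Rightarrow> real ^ 'n"
    by (rule continuous_on_compose2[OF that]) (use assms in \<open>auto intro!: continuous_intros\<close>)
  show "continuous_on \<Omega> (u t)"
    using u_slice_cont[of t] assms closure_subset continuous_on_subset by (metis less_imp_le)
  show "continuous_on \<Omega> (\<lambda>x. partial_deriv j (u t) x)"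
    "continuous_on \<Omega> (\<lambda>x. partial_deriv i (partial_deriv j (u t)) x)"
    "continuous_on \<Omega> (\<lambda>x. vector_derivative (\<lambda>s. u s x) (at t))"
    using *[OF pd_cont] *[OF pd2_cont] *[OF ut_cont] by simp_all
qed

lemma comp_cont:
  fixes g :: "'p::topological_space \<Rightarrow> real ^ 'n"
  assumes "continuous_on S g"
  shows "continuous_on S (\<lambda>x. \<Theta> (g x $ l))" "continuous_on S (\<lambda>x. \<theta> (g x $ l))"
    "continuous_on S (\<lambda>x. \<theta>' (g x $ l))"
  using assms by (auto intro!: continuous_on_compose2[OF cont_\<Theta>] continuous_on_compose2[OF cont_\<theta>]
      continuous_on_compose2[OF cont_\<theta>'] continuous_intros)

text \<open>Chain rule under the integral. The factor \<theta> cuts off a neighbourhood of the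
  boundary, where the time derivative of \<open>u\<close> need not be bounded.\<close>

lemma has_real_derivative_energy:
  assumes "t > 0"
  shows "((\<lambda>t. \<integral>x. \<Theta> (u t x $ l) \<partial>lebesgue_on \<Omega>) has_real_derivative
           (\<integral>x. \<theta> (u t x $ l) * vector_derivative (\<lambda>s. u s x) (at t) $ l \<partial>lebesgue_on \<Omega>)) (at t)"
proof -
  let ?f = "\<lambda>p. \<Theta> (u (fst p) (snd p) $ l)"
  let ?f' = "\<lambda>p. \<theta> (u (fst p) (snd p) $ l) * vector_derivative (\<lambda>s. u s (snd p)) (at (fst p)) $ l"
  have u: "continuous_on ({0<..} \<times> \<Omega>) (\<lambda>p. u (fst p) (snd p))"
    by (rule continuous_on_subset[OF u_cont]) (use closure_subset in auto)
  have "((\<lambda>s. \<integral>x. ?f (s, x) \<partial>lebesgue_on \<Omega>) has_vector_derivative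
      (\<integral>x. ?f' (t, x) \<partial>lebesgue_on \<Omega>)) (at t)"
  proof (rule has_vector_derivative_integral_vanishing[OF open_dom bounded_dom])
    show "continuous_on ({0<..} \<times> \<Omega>) ?f" by (rule comp_cont[OF u])
    show "continuous_on ({0<..} \<times> \<Omega>) ?f'" by (intro continuous_intros comp_cont u ut_cont)
    show "vanishes_near_boundary ({0<..} \<times> UNIV) ({0<..} \<times> \<Omega>) ?f"
      "vanishes_near_boundary ({0<..} \<times> UNIV) ({0<..} \<times> \<Omega>) ?f'"
      by (rule vanishing[OF \<epsilon>]; use zero_component in auto)+
    fix s :: real and x assume "s \<in> {0<..}" "x \<in> \<Omega>"
    then have "((\<lambda>s. u s x $ l) has_real_derivative vector_derivative (\<lambda>s. u s x) (at s) $ l) (at s)"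
      using has_vector_derivative_component[OF ut] has_real_derivative_iff_has_vector_derivative by auto
    from DERIV_chain2[OF D\<Theta> this]
    show "((\<lambda>s. ?f (s, x)) has_vector_derivative ?f' (s, x)) (at s)"
      by (simp add: has_real_derivative_iff_has_vector_derivative)
  qed (use assms in auto)
  then show ?thesis by (simp add: has_real_derivative_iff_has_vector_derivative)
qed

lemma has_vector_derivative_\<theta>_u:
  assumes "t > 0" "x \<in> \<Omega>"
  shows "((\<lambda>s. \<theta> (u t (x + s *\<^sub>R axis j 1) $ l)) has_vector_derivative
           \<theta>' (u t x $ l) * partial_deriv j (u t) x $ l) (at 0)"
proof -
  have "((\<lambda>s. u t (x + s *\<^sub>R axis j 1) $ l) has_real_derivative partial_deriv j (u t) x $ l) (at 0)"
    using has_vector_derivative_component[OF pd(1)[OF assms]]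
      has_real_derivative_iff_has_vector_derivative by auto
  from DERIV_chain2[OF D\<theta> this] show ?thesis
    by (simp add: has_real_derivative_iff_has_vector_derivative)
qed

text \<open>The derivative in direction \<open>j\<close> of
  \<open>\<theta> (u t x $ l) * partial_deriv j (u t) x $ l\<close> has integral zero. Its two
  product rule terms vanish near the boundary separately, hence are separately integrable.\<close>

lemma integral_by_parts:
  assumes t: "t > 0"
  shows "integrable (lebesgue_on \<Omega>) (\<lambda>x. \<theta> (u t x $ l) * partial_deriv j (partial_deriv j (u t)) x $ l)"
    and "integrable (lebesgue_on \<Omega>) (\<lambda>x. \<theta>' (u t x $ l) * (partial_deriv j (u t) x $ l)\<^sup>2)"
    and "(\<integral>x. \<theta> (u t x $ l) * partial_deriv j (partial_deriv j (u t)) x $ l \<partial>lebesgue_on \<Omega>) =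
           - (\<integral>x. \<theta>' (u t x $ l) * (partial_deriv j (u t) x $ l)\<^sup>2 \<partial>lebesgue_on \<Omega>)"
proof -
  let ?p = "\<lambda>x. partial_deriv j (u t) x $ l" and ?pp = "\<lambda>x. partial_deriv j (partial_deriv j (u t)) x $ l"
  note c = slices_cont[OF t]
  have van: "vanishes_near_boundary UNIV \<Omega> f" if "\<And>x. x \<in> \<Omega> \<Longrightarrow> norm (u t x) < \<epsilon> \<Longrightarrow> f x = 0"
    for f :: "real ^ 'm \<Rightarrow> real"
    by (rule vanishing_slice[OF \<epsilon> less_imp_le[OF t] that])
  show i1: "integrable (lebesgue_on \<Omega>) (\<lambda>x. \<theta> (u t x $ l) * ?pp x)"
    by (rule integrable_vanishing[OF open_dom bounded_dom])
       (use zero_component in \<open>auto intro!: continuous_intros comp_cont c van\<close>)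
  show i2: "integrable (lebesgue_on \<Omega>) (\<lambda>x. \<theta>' (u t x $ l) * (?p x)\<^sup>2)"
    by (rule integrable_vanishing[OF open_dom bounded_dom])
       (use zero_component in \<open>auto intro!: continuous_intros comp_cont c van\<close>)
  have "(\<integral>x. \<theta> (u t x $ l) * ?pp x + \<theta>' (u t x $ l) * (?p x)\<^sup>2 \<partial>lebesgue_on \<Omega>) = 0"
  proof (rule integral_directional_derivative_zero_on[OF open_dom bounded_dom,
        where f = "\<lambda>x. \<theta> (u t x $ l) * ?p x" and e = "axis j 1"])
    fix x assume x: "x \<in> \<Omega>"
    have "((\<lambda>s. \<theta> (u t (x + s *\<^sub>R axis j 1) $ l)) has_real_derivative \<theta>' (u t x $ l) * ?p x) (at 0)"
      "((\<lambda>s. ?p (x + s *\<^sub>R axis j 1)) has_real_derivative ?pp x) (at 0)"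
      using has_vector_derivative_\<theta>_u[OF t x] has_vector_derivative_component[OF pd(2)[OF t x]]
      by (auto simp: has_real_derivative_iff_has_vector_derivative)
    from DERIV_mult[OF this]
    show "((\<lambda>s. \<theta> (u t (x + s *\<^sub>R axis j 1) $ l) * ?p (x + s *\<^sub>R axis j 1)) has_vector_derivative
        \<theta> (u t x $ l) * ?pp x + \<theta>' (u t x $ l) * (?p x)\<^sup>2) (at 0)"
      by (simp add: has_real_derivative_iff_has_vector_derivative power2_eq_square algebra_simps)
  qed (use zero_component in \<open>auto intro!: continuous_intros comp_cont c van\<close>)
  then show "(\<integral>x. \<theta> (u t x $ l) * ?pp x \<partial>lebesgue_on \<Omega>) = - (\<integral>x. \<theta>' (u t x $ l) * (?p x)\<^sup>2 \<partial>lebesgue_on \<Omega>)"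
    using Bochner_Integration.integral_add[OF i1 i2] by simp
qed

lemma v_Dv_cont:
  assumes t: "t > 0"
  shows "continuous_on \<Omega> (v t)" "continuous_on \<Omega> (Dv j t)"
  by (intro continuous_intros comp_cont slices_cont[OF t])+

lemma v_Dv_vanishing:
  assumes t: "t > 0"
  shows "vanishes_near_boundary UNIV \<Omega> (v t)" "vanishes_near_boundary UNIV \<Omega> (Dv j t)"
  by (rule vanishing_slice[OF \<epsilon> less_imp_le[OF t]]; simp add: zero_component vec_eq_iff)+

lemma square_integrable_vanishing:
  fixes f :: "real ^ 'm \<Rightarrow> real ^ 'n"
  assumes "continuous_on \<Omega> f" "vanishes_near_boundary UNIV \<Omega> f"
  shows "square_integrable \<Omega> f"
proof -
  have "integrable (lebesgue_on \<Omega>) (\<lambda>x. (norm (f x))\<^sup>2)"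
    by (rule integrable_vanishing[OF open_dom bounded_dom])
       (use assms in \<open>auto intro!: continuous_intros vanishes_near_boundary_mono[OF assms(2)]\<close>)
  then show ?thesis
    using assms(1) open_dom by (simp add: square_integrable_def continuous_imp_measurable_on_sets_lebesgue)
qed

text \<open>The product of a test function with \<open>v\<close> inherits vanishing near the
  boundary from \<open>v\<close>, so the integral of its derivative is zero; the product rule then
  gives the weak identity.\<close>

lemma has_weak_deriv_v:
  assumes t: "t > 0"
  shows "has_weak_deriv \<Omega> [j] (v t) (Dv j t)"
  unfolding has_weak_deriv_def
proof (intro conjI allI impI)
  show "square_integrable \<Omega> (v t)" "square_integrable \<Omega> (Dv j t)"
    by (intro square_integrable_vanishing v_Dv_cont v_Dv_vanishing t)+
  fix \<phi> :: "real ^ 'm \<Rightarrow> real" assume "test_function \<Omega> \<phi>"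
  then have Ck: "Ck_on k \<phi> UNIV" for k by (simp add: test_function_def)
  have c\<phi>': "continuous_on UNIV (partial_deriv j \<phi>)" and d\<phi>: "\<phi> differentiable (at x)" for x
    using Ck[of "Suc 0"] by auto
  have c\<phi>: "continuous_on UNIV \<phi>" using Ck[of 0] by simp
  note c\<phi> = continuous_on_subset[OF c\<phi> subset_UNIV] continuous_on_subset[OF c\<phi>' subset_UNIV]
  have i1: "integrable (lebesgue_on \<Omega>) (\<lambda>x. partial_deriv j \<phi> x *\<^sub>R v t x)"
    by (rule integrable_vanishing[OF open_dom bounded_dom])
       (auto intro!: continuous_intros c\<phi> v_Dv_cont t vanishes_near_boundary_mono[OF v_Dv_vanishing(1)[OF t]])
  have i2: "integrable (lebesgue_on \<Omega>) (\<lambda>x. \<phi> x *\<^sub>R Dv j t x)"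
    by (rule integrable_vanishing[OF open_dom bounded_dom])
       (auto intro!: continuous_intros c\<phi> v_Dv_cont t vanishes_near_boundary_mono[OF v_Dv_vanishing(2)[OF t]])
  have "(\<integral>x. partial_deriv j \<phi> x *\<^sub>R v t x + \<phi> x *\<^sub>R Dv j t x \<partial>lebesgue_on \<Omega>) = 0"
  proof (rule integral_directional_derivative_zero_on[OF open_dom bounded_dom,
        where f = "\<lambda>x. \<phi> x *\<^sub>R v t x" and e = "axis j 1"])
    show "continuous_on \<Omega> (\<lambda>x. \<phi> x *\<^sub>R v t x)"
      "continuous_on \<Omega> (\<lambda>x. partial_deriv j \<phi> x *\<^sub>R v t x + \<phi> x *\<^sub>R Dv j t x)"
      by (intro continuous_on_add continuous_on_scaleR c\<phi> v_Dv_cont t)+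
    show "vanishes_near_boundary UNIV \<Omega> (\<lambda>x. \<phi> x *\<^sub>R v t x)"
      "vanishes_near_boundary UNIV \<Omega> (\<lambda>x. partial_deriv j \<phi> x *\<^sub>R v t x + \<phi> x *\<^sub>R Dv j t x)"
      by (rule vanishing_slice[OF \<epsilon> less_imp_le[OF t]]; simp add: zero_component vec_eq_iff)+
    fix x assume x: "x \<in> \<Omega>"
    have 1: "((\<lambda>s. \<phi> (x + s *\<^sub>R axis j 1)) has_real_derivative partial_deriv j \<phi> x) (at 0)"
      using has_vector_derivative_partial_deriv[OF d\<phi>]
      by (simp add: has_real_derivative_iff_has_vector_derivative)
    have 2: "((\<lambda>s. v t (x + s *\<^sub>R axis j 1)) has_vector_derivative Dv j t x) (at 0)"
      unfolding has_vector_derivative_def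
      by (subst has_derivative_componentwise_within, rule ballI)
         (use has_vector_derivative_\<theta>_u[OF t x] in
           \<open>auto simp: Basis_vec_def inner_axis has_vector_derivative_def algebra_simps\<close>)
    show "((\<lambda>s. \<phi> (x + s *\<^sub>R axis j 1) *\<^sub>R v t (x + s *\<^sub>R axis j 1)) has_vector_derivative
        partial_deriv j \<phi> x *\<^sub>R v t x + \<phi> x *\<^sub>R Dv j t x) (at 0)"
      using has_vector_derivative_scaleR[OF 1 2] by (simp add: add.commute)
  qed
  then show "(\<integral>x. partial_derivs [j] \<phi> x *\<^sub>R v t x \<partial>lebesgue_on \<Omega>) =
      (-1) ^ length [j] *\<^sub>R (\<integral>x. \<phi> x *\<^sub>R Dv j t x \<partial>lebesgue_on \<Omega>)"
    using Bochner_Integration.integral_add[OF i1 i2] by (simp add: add_eq_0_iff2)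
qed

text \<open>\<open>v\<close> is admissible in the Poincare inequality: it is continuous up to the
  boundary, and zero there since \<open>\<theta> 0 = 0\<close>. Its squared gradient carries the
  weight \<open>\<theta>'^2\<close>; passing to the weight \<open>\<theta>'\<close> produces exactly
  the dissipation of \<open>integral_by_parts\<close>.\<close>

lemma poincare_v:
  assumes t: "t > 0" and P: "poincare_constant TYPE(real ^ 'n) \<Omega> c"
  shows "c * (\<integral>x. (norm (v t x))\<^sup>2 \<partial>lebesgue_on \<Omega>)
    \<le> (\<Sum>l\<in>UNIV. \<Sum>j\<in>UNIV. \<integral>x. \<theta>' (u t x $ l) * (partial_deriv j (u t) x $ l)\<^sup>2 \<partial>lebesgue_on \<Omega>)"
proof -
  have i: "integrable (lebesgue_on \<Omega>) (\<lambda>x. (norm (Dv j t x))\<^sup>2)" for j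
    using has_weak_deriv_v[OF t] by (simp add: has_weak_deriv_def square_integrable_def)
  have "continuous_on (closure \<Omega>) (v t)"
    by (intro continuous_intros comp_cont u_slice_cont less_imp_le[OF t])
  moreover have "v t x = 0" if "x \<in> frontier \<Omega>" for x
    using u_frontier[OF less_imp_le[OF t] that] zero(2)[of 0] \<epsilon> by (simp add: vec_eq_iff)
  ultimately have "c * (\<integral>x. (norm (v t x))\<^sup>2 \<partial>lebesgue_on \<Omega>)
      \<le> (\<integral>x. (\<Sum>j\<in>UNIV. (norm (Dv j t x))\<^sup>2) \<partial>lebesgue_on \<Omega>)"
    using P[unfolded poincare_constant_def, rule_format, of "v t" "\<lambda>j. Dv j t"] has_weak_deriv_v[OF t] by blast
  also have "\<dots> \<le> (\<integral>x. (\<Sum>j\<in>UNIV. \<Sum>l\<in>UNIV. \<theta>' (u t x $ l) * (partial_deriv j (u t) x $ l)\<^sup>2) \<partial>lebesgue_on \<Omega>)"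
  proof (rule integral_mono)
    fix x
    have "(norm (Dv j t x))\<^sup>2 \<le> (\<Sum>l\<in>UNIV. \<theta>' (u t x $ l) * (partial_deriv j (u t) x $ l)\<^sup>2)" for j
    proof -
      have "(\<theta>' (u t x $ l) * partial_deriv j (u t) x $ l)\<^sup>2
          \<le> \<theta>' (u t x $ l) * (partial_deriv j (u t) x $ l)\<^sup>2" for l
        unfolding power_mult_distrib using \<theta>'_01[of "u t x $ l"]
        by (intro mult_right_mono) (auto simp: power2_eq_square mult_left_le)
      then show ?thesis by (simp add: norm_vec_def L2_set_def sum_nonneg sum_mono)
    qed
    then show "(\<Sum>j\<in>UNIV. (norm (Dv j t x))\<^sup>2)
        \<le> (\<Sum>j\<in>UNIV. \<Sum>l\<in>UNIV. \<theta>' (u t x $ l) * (partial_deriv j (u t) x $ l)\<^sup>2)" by (rule sum_mono)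
  qed (intro Bochner_Integration.integrable_sum i integral_by_parts t)+
  also have "\<dots> = (\<Sum>j\<in>UNIV. \<Sum>l\<in>UNIV. \<integral>x. \<theta>' (u t x $ l) * (partial_deriv j (u t) x $ l)\<^sup>2 \<partial>lebesgue_on \<Omega>)"
    using integral_by_parts(2)[OF t] by (simp add: Bochner_Integration.integral_sum)
  also have "\<dots> = (\<Sum>l\<in>UNIV. \<Sum>j\<in>UNIV. \<integral>x. \<theta>' (u t x $ l) * (partial_deriv j (u t) x $ l)\<^sup>2 \<partial>lebesgue_on \<Omega>)"
    by (rule sum.swap)
  finally show ?thesis .
qed

end

text \<open>The differential inequality \<open>f' \<le> h\<close> for a function \<open>f\<close> that need not be differentiable.\<close>

definition approx_deriv_le :: "real \<Rightarrow> (real \<Rightarrow> real) \<Rightarrow> (real \<Rightarrow> real) \<Rightarrow> bool" where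
  "approx_deriv_le T f h \<longleftrightarrow> (\<exists>K. \<forall>\<epsilon>. 0 < \<epsilon> \<longrightarrow> \<epsilon> \<le> 1 \<longrightarrow> (\<exists>E E'. continuous_on {0..T} E \<and>
     (\<forall>t\<in>{0..T}. \<bar>E t - f t\<bar> \<le> K * \<epsilon>) \<and>
     (\<forall>t\<in>{0<..<T}. (E has_real_derivative E' t) (at t) \<and> E' t \<le> h t + K * \<epsilon>)))"

text \<open>For integrands built from \<open>u\<close> itself, which need not vanish near the
  boundary; boundedness on a set of finite measure takes the place of the zero extension.\<close>

lemma integrable_lebesgue_on_bounded_continuous:
  fixes f :: "'a::euclidean_space \<Rightarrow> 'b::euclidean_space"
  assumes "open \<Omega>" "bounded \<Omega>" "continuous_on \<Omega> f" "\<And>x. x \<in> \<Omega> \<Longrightarrow> norm (f x) \<le> B"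
  shows "integrable (lebesgue_on \<Omega>) f"
proof -
  interpret finite_measure "lebesgue_on \<Omega>"
    by (rule finite_measure_lebesgue_on) (use assms in \<open>auto intro: lmeasurable_open\<close>)
  show ?thesis
    by (rule integrable_const_bound[of _ B])
       (use assms in \<open>auto intro!: AE_I2 continuous_imp_measurable_on_sets_lebesgue\<close>)
qed

text \<open>Turns a uniform pointwise truncation error into an error of the integral.\<close>

lemma integral_lebesgue_on_le_add:
  fixes f g :: "'a::euclidean_space \<Rightarrow> real"
  assumes \<Omega>: "\<Omega> \<in> lmeasurable" and f: "integrable (lebesgue_on \<Omega>) f" and g: "integrable (lebesgue_on \<Omega>) g"
    and le: "\<And>x. x \<in> \<Omega> \<Longrightarrow> f x \<le> g x + B"
  shows "(\<integral>x. f x \<partial>lebesgue_on \<Omega>) \<le> (\<integral>x. g x \<partial>lebesgue_on \<Omega>) + B * measure lebesgue \<Omega>"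
proof -
  interpret finite_measure "lebesgue_on \<Omega>" by (rule finite_measure_lebesgue_on[OF \<Omega>])
  have "(\<integral>x. f x \<partial>lebesgue_on \<Omega>) \<le> (\<integral>x. g x + B \<partial>lebesgue_on \<Omega>)"
    by (rule integral_mono) (use f g le in auto)
  also have "\<dots> = (\<integral>x. g x \<partial>lebesgue_on \<Omega>) + B * measure lebesgue \<Omega>"
    using g \<Omega> by (simp add: measure_restrict_space mult.commute)
  finally show ?thesis .
qed

text \<open>Read off from the equation: in \<Omega> the term equals the time derivative minus
  \<open>D t *v laplacian (u t) x\<close>, and both are continuous for \<open>t > 0\<close>.\<close>

lemma (in dirichlet_flow) F_u_cont:
  assumes t: "t > 0"
  shows "continuous_on \<Omega> (\<lambda>x. F (u t x) x t)"
proof -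
  have slice: "continuous_on \<Omega> (\<lambda>x. f (t, x))" if "continuous_on ({0<..} \<times> \<Omega>) f"
    for f :: "real \<times> (real ^ 'm) \<Rightarrow> real ^ 'n"
    by (rule continuous_on_compose2[OF that]) (use t in \<open>auto intro!: continuous_intros\<close>)
  have "continuous_on \<Omega> (\<lambda>x. vector_derivative (\<lambda>s. u s x) (at t) - D t *v laplacian (u t) x)"
    unfolding laplacian_def partial_derivs.simps
    using slice[OF ut_cont] slice[OF pd2_cont]
    by (auto intro!: continuous_intros bounded_linear.continuous_on[OF matrix_vector_mul_bounded_linear])
  then show ?thesis by (rule continuous_on_eq) (simp add: equation[OF t])
qed

section \<open>Derivative and continuity of the truncated energy\<close>

context truncated_flow
begin

text \<open>The equation is tested with \<open>v\<close>. As \<open>D t\<close> is diagonal,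
  component \<open>l\<close> integrates by parts with its own coefficient
  \<open>D t $ l $ l\<close>. The dissipation integrals are nonnegative, so all coefficients may be
  lowered to \<delta> before the Poincare inequality is applied to the sum.\<close>

lemma energy_derivative_le:
  assumes t: "t > 0" and P: "poincare_constant TYPE(real ^ 'n) \<Omega> c"
    and \<delta>: "0 \<le> \<delta>" "\<And>l. \<delta> \<le> D t $ l $ l"
  shows "integrable (lebesgue_on \<Omega>) (\<lambda>x. v t x \<bullet> F (u t x) x t)"
    and "(\<Sum>l\<in>UNIV. \<integral>x. \<theta> (u t x $ l) * vector_derivative (\<lambda>s. u s x) (at t) $ l \<partial>lebesgue_on \<Omega>)
      \<le> - \<delta> * c * (\<integral>x. (norm (v t x))\<^sup>2 \<partial>lebesgue_on \<Omega>) + (\<integral>x. v t x \<bullet> F (u t x) x t \<partial>lebesgue_on \<Omega>)"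
proof -
  let ?F = "\<lambda>x. F (u t x) x t"
  let ?pp = "\<lambda>j l x. partial_deriv j (partial_deriv j (u t)) x $ l"
  let ?Q = "\<lambda>j l. \<integral>x. \<theta>' (u t x $ l) * (partial_deriv j (u t) x $ l)\<^sup>2 \<partial>lebesgue_on \<Omega>"
  have iF: "integrable (lebesgue_on \<Omega>) (\<lambda>x. \<theta> (u t x $ l) * ?F x $ l)" for l
    by (rule integrable_vanishing[OF open_dom bounded_dom])
       (auto intro!: continuous_intros comp_cont slices_cont t F_u_cont vanishing_slice[OF \<epsilon> less_imp_le[OF t]]
          simp: zero_component)
  have iP: "integrable (lebesgue_on \<Omega>) (\<lambda>x. \<theta> (u t x $ l) * ?pp j l x)" for j l
    by (rule integral_by_parts[OF t])
  have vF: "v t x \<bullet> ?F x = (\<Sum>l\<in>UNIV. \<theta> (u t x $ l) * ?F x $ l)" for x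
    by (simp add: inner_vec_def)
  show "integrable (lebesgue_on \<Omega>) (\<lambda>x. v t x \<bullet> ?F x)"
    unfolding vF by (intro Bochner_Integration.integrable_sum iF)
  have eq: "(\<integral>x. \<theta> (u t x $ l) * vector_derivative (\<lambda>s. u s x) (at t) $ l \<partial>lebesgue_on \<Omega>)
      = - D t $ l $ l * (\<Sum>j\<in>UNIV. ?Q j l) + (\<integral>x. \<theta> (u t x $ l) * ?F x $ l \<partial>lebesgue_on \<Omega>)" for l
  proof -
    have "vector_derivative (\<lambda>s. u s x) (at t) $ l = D t $ l $ l * (\<Sum>j\<in>UNIV. ?pp j l x) + ?F x $ l"
      if "x \<in> \<Omega>" for x
    proof -
      have "(D t *v laplacian (u t) x) $ l = (\<Sum>i\<in>UNIV. if i = l then D t $ l $ l * laplacian (u t) x $ l else 0)"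
        unfolding matrix_vector_mult_def vec_lambda_beta by (rule sum.cong) (use D_diag[OF t] in auto)
      then show ?thesis using equation[OF t that] by (simp add: laplacian_def)
    qed
    then have "(\<integral>x. \<theta> (u t x $ l) * vector_derivative (\<lambda>s. u s x) (at t) $ l \<partial>lebesgue_on \<Omega>)
      = (\<integral>x. D t $ l $ l * (\<Sum>j\<in>UNIV. \<theta> (u t x $ l) * ?pp j l x) + \<theta> (u t x $ l) * ?F x $ l \<partial>lebesgue_on \<Omega>)"
      by (intro Bochner_Integration.integral_cong) (auto simp: sum_distrib_left algebra_simps)
    also have "\<dots> = D t $ l $ l * (\<Sum>j\<in>UNIV. \<integral>x. \<theta> (u t x $ l) * ?pp j l x \<partial>lebesgue_on \<Omega>)
        + (\<integral>x. \<theta> (u t x $ l) * ?F x $ l \<partial>lebesgue_on \<Omega>)"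
      using iP iF by (simp add: Bochner_Integration.integral_sum Bochner_Integration.integrable_sum)
    finally show ?thesis by (simp add: integral_by_parts(3)[OF t] sum_negf)
  qed
  have Q: "?Q j l \<ge> 0" for j l
    by (intro integral_nonneg_AE AE_I2) (simp add: \<theta>'_01)
  have "\<delta> * (c * (\<integral>x. (norm (v t x))\<^sup>2 \<partial>lebesgue_on \<Omega>)) \<le> \<delta> * (\<Sum>l\<in>UNIV. \<Sum>j\<in>UNIV. ?Q j l)"
    by (intro mult_left_mono poincare_v t P \<delta>)
  also have "\<dots> = (\<Sum>l\<in>UNIV. \<delta> * (\<Sum>j\<in>UNIV. ?Q j l))" by (rule sum_distrib_left)
  also have "\<dots> \<le> (\<Sum>l\<in>UNIV. D t $ l $ l * (\<Sum>j\<in>UNIV. ?Q j l))"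
    by (intro sum_mono mult_right_mono sum_nonneg \<delta> Q)
  finally show "(\<Sum>l\<in>UNIV. \<integral>x. \<theta> (u t x $ l) * vector_derivative (\<lambda>s. u s x) (at t) $ l \<partial>lebesgue_on \<Omega>)
      \<le> - \<delta> * c * (\<integral>x. (norm (v t x))\<^sup>2 \<partial>lebesgue_on \<Omega>) + (\<integral>x. v t x \<bullet> ?F x \<partial>lebesgue_on \<Omega>)"
    unfolding eq vF using iF by (simp add: sum.distrib sum_negf sum_subtractf Bochner_Integration.integral_sum mult.assoc)
qed

text \<open>Freezing \<open>u\<close> at its initial value for negative times makes the time set open.\<close>

lemma continuous_on_energy: "continuous_on {0..} (\<lambda>t. \<integral>x. \<Theta> (u t x $ l) \<partial>lebesgue_on \<Omega>)"
proof -
  let ?w = "\<lambda>p. u (max 0 (fst p)) (snd p)"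
  let ?f = "\<lambda>p. \<Theta> (?w p $ l)"
  have w: "continuous_on (UNIV \<times> closure \<Omega>) ?w"
    using continuous_on_compose2[OF u_cont, of "UNIV \<times> closure \<Omega>" "\<lambda>p. (max 0 (fst p), snd p)"]
    by (simp add: continuous_intros image_subset_iff)
  then have w': "continuous_on (UNIV \<times> \<Omega>) ?w"
    by (rule continuous_on_subset) (use closure_subset in auto)
  have "continuous_on UNIV (\<lambda>t. \<integral>x. ?f (t, x) \<partial>lebesgue_on \<Omega>)"
  proof (rule continuous_on_integral_vanishing[OF open_dom bounded_dom open_UNIV comp_cont(1)[OF w']])
    show "vanishes_near_boundary (UNIV \<times> UNIV) (UNIV \<times> \<Omega>) ?f"
      by (rule vanishes_near_boundaryI[OF open_dom w _ \<epsilon>]) (auto simp: zero_component u_frontier)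
  qed
  then have "continuous_on {0..} (\<lambda>t. \<integral>x. ?f (t, x) \<partial>lebesgue_on \<Omega>)"
    by (rule continuous_on_subset) auto
  then show ?thesis by (rule continuous_on_eq) (simp add: max_absorb2)
qed

end

section \<open>Removal of the truncation: the energy inequality for the solution\<close>

context dirichlet_flow
begin

lemma u_bounded:
  obtains R where "R \<ge> 0" "\<And>t x. 0 \<le> t \<Longrightarrow> t \<le> T \<Longrightarrow> x \<in> closure \<Omega> \<Longrightarrow> norm (u t x) \<le> R"
proof -
  have "compact ({0..T} \<times> closure \<Omega>)" using bounded_dom by (intro compact_Times) auto
  moreover have "continuous_on ({0..T} \<times> closure \<Omega>) (\<lambda>p. u (fst p) (snd p))"
    by (rule continuous_on_subset[OF u_cont]) auto
  ultimately have "bounded ((\<lambda>p. u (fst p) (snd p)) ` ({0..T} \<times> closure \<Omega>))"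
    by (intro compact_imp_bounded compact_continuous_image)
  then obtain R where "\<And>p. p \<in> {0..T} \<times> closure \<Omega> \<Longrightarrow> norm (u (fst p) (snd p)) \<le> R"
    unfolding bounded_iff by blast
  \<comment> \<open>For negative \<open>T\<close> the cylinder is empty and \<open>R\<close> may be
    negative, hence \<open>max R 0\<close>.\<close>
  from this[of "(_, _)"] have "norm (u t x) \<le> max R 0" if "0 \<le> t" "t \<le> T" "x \<in> closure \<Omega>" for t x
    using that by (simp add: le_max_iff_disj)
  then show thesis by (intro that[of "max R 0"]) auto
qed

lemma integrable_norm_square_u: "t \<ge> 0 \<Longrightarrow> integrable (lebesgue_on \<Omega>) (\<lambda>x. (norm (u t x))\<^sup>2)"
proof -
  assume t: "t \<ge> 0"
  obtain R where R: "\<And>x. x \<in> closure \<Omega> \<Longrightarrow> norm (u t x) \<le> R" using u_bounded[of t] t by (metis order_refl)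
  show ?thesis
  proof (rule integrable_lebesgue_on_bounded_continuous[OF open_dom bounded_dom, of _ "R\<^sup>2"])
    show "continuous_on \<Omega> (\<lambda>x. (norm (u t x))\<^sup>2)"
      by (intro continuous_intros continuous_on_subset[OF u_slice_cont[OF t] closure_subset])
    show "norm ((norm (u t x))\<^sup>2) \<le> R\<^sup>2" if "x \<in> \<Omega>" for x
      using R[of x] that closure_subset[of \<Omega>] by (auto intro!: power_mono)
  qed
qed

lemma L2_norm_u_square: "(L2_norm \<Omega> (u t))\<^sup>2 = (\<integral>x. (norm (u t x))\<^sup>2 \<partial>lebesgue_on \<Omega>)"
  by (simp add: L2_norm_def integral_nonneg_AE)

lemma integrable_inner_F_u:
  assumes t: "t > 0" and M: "\<And>v x. norm (F v x t) \<le> M"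
  shows "integrable (lebesgue_on \<Omega>) (\<lambda>x. u t x \<bullet> F (u t x) x t)"
proof -
  obtain R where R: "R \<ge> 0" "\<And>x. x \<in> closure \<Omega> \<Longrightarrow> norm (u t x) \<le> R" using u_bounded[of t] t by (metis less_imp_le order_refl)
  show ?thesis
  proof (rule integrable_lebesgue_on_bounded_continuous[OF open_dom bounded_dom, of _ "R * M"])
    show "continuous_on \<Omega> (\<lambda>x. u t x \<bullet> F (u t x) x t)"
      using t by (intro continuous_intros F_u_cont continuous_on_subset[OF u_slice_cont closure_subset]) auto
    show "norm (u t x \<bullet> F (u t x) x t) \<le> R * M" if "x \<in> \<Omega>" for x
      using R(2)[of x] that closure_subset[of \<Omega>] M R(1)
      by (auto intro!: order_trans[OF Cauchy_Schwarz_ineq2] mult_mono)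
  qed
qed

text \<open>For each \<epsilon> the approximating function is the truncated energy, the sum over
  \<open>l\<close> of the integrals of \<open>\<Theta> (u t x $ l)\<close>. Replacing
  \<open>v\<close> by \<open>u\<close> in its derivative bound costs a multiple of \<epsilon> that
  is uniform in \<open>t\<close>; this uniformity is the purpose of \<open>R\<close>,
  \<open>\<delta>max\<close> and \<open>M\<close>.\<close>

lemma energy_inequality:
  assumes P: "poincare_constant TYPE(real ^ 'n) \<Omega> c" and c: "c \<ge> 0"
    and M: "\<And>v x t. t > 0 \<Longrightarrow> norm (F v x t) \<le> M"
    and \<delta>: "\<And>t. t > 0 \<Longrightarrow> 0 \<le> \<delta> t" "\<And>t. t > 0 \<Longrightarrow> \<delta> t \<le> \<delta>max" "\<And>t l. t > 0 \<Longrightarrow> \<delta> t \<le> D t $ l $ l"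
  shows "approx_deriv_le T (\<lambda>t. (L2_norm \<Omega> (u t))\<^sup>2 / 2)
    (\<lambda>t. - \<delta> t * c * (L2_norm \<Omega> (u t))\<^sup>2 + (\<integral>x. u t x \<bullet> F (u t x) x t \<partial>lebesgue_on \<Omega>))"
proof -
  obtain R where R: "R \<ge> 0" "\<And>t x. 0 \<le> t \<Longrightarrow> t \<le> T \<Longrightarrow> x \<in> closure \<Omega> \<Longrightarrow> norm (u t x) \<le> R"
    using u_bounded[of T] by metis
  define N V where "N = real CARD('n)" and "V = measure lebesgue \<Omega>"
  \<comment> \<open>The summands pay for three errors: \<open>2 * R\<close> for \<Theta> against
    half the square, \<open>4 * (R + 1) * \<delta>max * c\<close> for the square of \<theta> in the
    Poincare term, and \<open>2 * M\<close> for \<theta> multiplied by \<open>F\<close>. The factor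
    \<open>N * V\<close> comes from summing components and integrating over \<Omega>.\<close>
  define K where "K = N * V * (2 * R + 4 * (R + 1) * \<delta>max * c + 2 * M)"
  have M0: "M \<ge> 0" using M[of 1 0 0] norm_ge_zero order_trans by (metis zero_less_one)
  have \<delta>0: "\<delta>max \<ge> 0" using \<delta>(1)[of 1] \<delta>(2)[of 1] by simp
  have V: "V \<ge> 0" and N: "N \<ge> 0" by (auto simp: V_def N_def)
  have lm: "\<Omega> \<in> lmeasurable" using open_dom bounded_dom by (simp add: lmeasurable_open)
  show ?thesis
    unfolding approx_deriv_le_def
  proof (intro exI[of _ K] allI impI)
    fix \<epsilon> :: real assume \<epsilon>: "0 < \<epsilon>" "\<epsilon> \<le> 1"
    obtain \<Theta> \<theta> \<theta>' where trunc:
      "\<And>r. (\<Theta> has_real_derivative \<theta> r) (at r)" "\<And>r. (\<theta> has_real_derivative \<theta>' r) (at r)"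
      "continuous_on UNIV \<theta>'" "\<And>r. 0 \<le> \<theta>' r" "\<And>r. \<theta>' r \<le> 1"
      "\<And>r. \<bar>r\<bar> < \<epsilon> \<Longrightarrow> \<Theta> r = 0" "\<And>r. \<bar>r\<bar> < \<epsilon> \<Longrightarrow> \<theta> r = 0" "\<And>r. \<bar>r\<bar> < \<epsilon> \<Longrightarrow> \<theta>' r = 0"
      and approx: "\<And>r. \<bar>\<theta> r - r\<bar> \<le> 2 * \<epsilon>" "\<And>r. \<bar>\<Theta> r - r\<^sup>2 / 2\<bar> \<le> 2 * \<epsilon> * \<bar>r\<bar>"
      using smooth_truncation[OF \<epsilon>(1)] by metis
    interpret tr: truncated_flow \<Omega> D F u\<^sub>0 u \<epsilon> \<Theta> \<theta> \<theta>'
      by unfold_locales (use \<epsilon>(1) trunc in auto)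
    define E where "E t = (\<Sum>l\<in>UNIV. \<integral>x. \<Theta> (u t x $ l) \<partial>lebesgue_on \<Omega>)" for t
    define E' where "E' t = (\<Sum>l\<in>UNIV. \<integral>x. \<theta> (u t x $ l) *
        vector_derivative (\<lambda>s. u s x) (at t) $ l \<partial>lebesgue_on \<Omega>)" for t
    have E_cont: "continuous_on {0..} E"
      unfolding E_def by (intro continuous_on_sum tr.continuous_on_energy)
    have E_deriv: "(E has_real_derivative E' t) (at t)" if "t > 0" for t
      unfolding E_def[abs_def] E'_def by (intro DERIV_sum tr.has_real_derivative_energy that)
    have comp: "\<bar>u t x $ l\<bar> \<le> R" if "0 \<le> t" "t \<le> T" "x \<in> \<Omega>" for t x l
      using R(2)[OF that(1,2), of x] component_le_norm_cart[of "u t x" l] that(3) closure_subset[of \<Omega>] by force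
    have norm_sq: "(norm (w :: real ^ 'n))\<^sup>2 = (\<Sum>l\<in>UNIV. (w $ l)\<^sup>2)" for w
      by (simp add: norm_vec_def L2_set_def sum_nonneg)
    have sum_bound: "(\<Sum>l\<in>UNIV. f l) \<le> (\<Sum>l\<in>UNIV. g l) + N * b" if "\<And>l. f l \<le> g l + b" for f g :: "'n \<Rightarrow> real" and b
    proof -
      have "(\<Sum>l\<in>UNIV. f l) \<le> (\<Sum>l\<in>UNIV. g l + b)" by (intro sum_mono that)
      then show ?thesis by (simp add: sum.distrib N_def)
    qed
    have 1: "\<bar>E t - (L2_norm \<Omega> (u t))\<^sup>2 / 2\<bar> \<le> K * \<epsilon>" if t: "t \<in> {0..T}" for t
    proof -
      have i: "integrable (lebesgue_on \<Omega>) (\<lambda>x. \<Theta> (u t x $ l))" for l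
        by (rule integrable_vanishing[OF open_dom bounded_dom])
           (use t in \<open>auto intro!: tr.comp_cont continuous_on_subset[OF u_slice_cont closure_subset]
              vanishing_slice[OF \<epsilon>(1)] simp: tr.zero_component\<close>)
      then have iS: "integrable (lebesgue_on \<Omega>) (\<lambda>x. \<Sum>l\<in>UNIV. \<Theta> (u t x $ l))" by simp
      have iu: "integrable (lebesgue_on \<Omega>) (\<lambda>x. (norm (u t x))\<^sup>2 / 2)"
        using integrable_norm_square_u t by simp
      have E: "E t = (\<integral>x. (\<Sum>l\<in>UNIV. \<Theta> (u t x $ l)) \<partial>lebesgue_on \<Omega>)"
        unfolding E_def using i by (simp add: Bochner_Integration.integral_sum)
      have pt: "\<bar>\<Theta> (u t x $ l) - (u t x $ l)\<^sup>2 / 2\<bar> \<le> 2 * \<epsilon> * R" if "x \<in> \<Omega>" for x l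
        using order_trans[OF approx(2), of "u t x $ l" "2 * \<epsilon> * R"] comp[OF _ _ that, of t l] t \<epsilon>(1) by simp
      have pt_sum: "(\<Sum>l\<in>UNIV. \<Theta> (u t x $ l)) \<le> (norm (u t x))\<^sup>2 / 2 + N * (2 * \<epsilon> * R)"
        "(norm (u t x))\<^sup>2 / 2 \<le> (\<Sum>l\<in>UNIV. \<Theta> (u t x $ l)) + N * (2 * \<epsilon> * R)" if "x \<in> \<Omega>" for x
        unfolding norm_sq sum_divide_distrib by (rule sum_bound, use pt[OF that] in \<open>simp add: abs_le_iff algebra_simps\<close>)+
      have "E t \<le> (\<integral>x. (norm (u t x))\<^sup>2 / 2 \<partial>lebesgue_on \<Omega>) + N * (2 * \<epsilon> * R) * V"
        unfolding E V_def
        by (rule integral_lebesgue_on_le_add[OF lm iS iu pt_sum(1)])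
      moreover have "(\<integral>x. (norm (u t x))\<^sup>2 / 2 \<partial>lebesgue_on \<Omega>) \<le> E t + N * (2 * \<epsilon> * R) * V"
        unfolding E V_def
        by (rule integral_lebesgue_on_le_add[OF lm iu iS pt_sum(2)])
      moreover have "N * (2 * \<epsilon> * R) * V \<le> K * \<epsilon>"
      proof -
        have "K * \<epsilon> - N * (2 * \<epsilon> * R) * V = N * V * (4 * (R + 1) * \<delta>max * c + 2 * M) * \<epsilon>"
          by (simp add: K_def algebra_simps)
        also have "\<dots> \<ge> 0" using N V R(1) \<delta>0 c M0 \<epsilon> by simp
        finally show ?thesis by simp
      qed
      ultimately show ?thesis unfolding L2_norm_u_square by simp
    qed
    have 2: "E' t \<le> - \<delta> t * c * (L2_norm \<Omega> (u t))\<^sup>2 + (\<integral>x. u t x \<bullet> F (u t x) x t \<partial>lebesgue_on \<Omega>) + K * \<epsilon>"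
      if t: "t \<in> {0<..T}" for t
    proof -
      have t0: "t > 0" using t by simp
      have iv: "integrable (lebesgue_on \<Omega>) (\<lambda>x. (norm (tr.v t x))\<^sup>2)"
        using tr.has_weak_deriv_v[OF t0] by (simp add: has_weak_deriv_def square_integrable_def)
      have "(\<integral>x. (norm (u t x))\<^sup>2 \<partial>lebesgue_on \<Omega>)
          \<le> (\<integral>x. (norm (tr.v t x))\<^sup>2 \<partial>lebesgue_on \<Omega>) + N * (4 * (R + 1) * \<epsilon>) * V"
        unfolding V_def
      proof (rule integral_lebesgue_on_le_add[OF lm _ iv])
        fix x assume x: "x \<in> \<Omega>"
        show "(norm (u t x))\<^sup>2 \<le> (norm (tr.v t x))\<^sup>2 + N * (4 * (R + 1) * \<epsilon>)"
          unfolding norm_sq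
        proof (rule sum_bound)
          fix l
          let ?r = "u t x $ l"
          have "?r\<^sup>2 - (\<theta> ?r)\<^sup>2 = (?r - \<theta> ?r) * (?r + \<theta> ?r)"
            by (simp add: power2_eq_square algebra_simps)
          also have "\<dots> \<le> \<bar>?r - \<theta> ?r\<bar> * \<bar>?r + \<theta> ?r\<bar>" by (simp add: abs_mult[symmetric])
          \<comment> \<open>Here \<open>\<epsilon> \<le> 1\<close> is used: \<open>\<bar>?r +
            \<theta> ?r\<bar> \<le> 2 * R + 2 * \<epsilon> \<le> 2 * (R + 1)\<close>.\<close>
          also have "\<dots> \<le> (2 * \<epsilon>) * (2 * (R + 1))"
            using approx(1)[of ?r] comp[OF _ _ x, of t l] t \<epsilon> by (intro mult_mono) auto
          finally show "?r\<^sup>2 \<le> (tr.v t x $ l)\<^sup>2 + 4 * (R + 1) * \<epsilon>" by (simp add: algebra_simps)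
        qed
      qed (use integrable_norm_square_u t in simp)
      then have "\<delta> t * c * (\<integral>x. (norm (u t x))\<^sup>2 \<partial>lebesgue_on \<Omega>)
          \<le> \<delta> t * c * ((\<integral>x. (norm (tr.v t x))\<^sup>2 \<partial>lebesgue_on \<Omega>) + N * (4 * (R + 1) * \<epsilon>) * V)"
        using \<delta>(1)[OF t0] c by (intro mult_left_mono) auto
      also have "\<dots> \<le> \<delta> t * c * (\<integral>x. (norm (tr.v t x))\<^sup>2 \<partial>lebesgue_on \<Omega>)
          + \<delta>max * c * (N * (4 * (R + 1) * \<epsilon>) * V)"
        unfolding distrib_left using \<delta>(2)[OF t0] c N V R(1) \<epsilon>
        by (intro add_left_mono mult_right_mono) auto
      finally have a: "- \<delta> t * c * (\<integral>x. (norm (tr.v t x))\<^sup>2 \<partial>lebesgue_on \<Omega>)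
        \<le> - \<delta> t * c * (\<integral>x. (norm (u t x))\<^sup>2 \<partial>lebesgue_on \<Omega>) + \<delta>max * c * (N * (4 * (R + 1) * \<epsilon>) * V)"
        by simp
      have b: "(\<integral>x. tr.v t x \<bullet> F (u t x) x t \<partial>lebesgue_on \<Omega>)
          \<le> (\<integral>x. u t x \<bullet> F (u t x) x t \<partial>lebesgue_on \<Omega>) + N * (2 * \<epsilon> * M) * V"
        unfolding V_def
      proof (rule integral_lebesgue_on_le_add[OF lm])
        fix x assume x: "x \<in> \<Omega>"
        show "tr.v t x \<bullet> F (u t x) x t \<le> u t x \<bullet> F (u t x) x t + N * (2 * \<epsilon> * M)"
          unfolding inner_vec_def
        proof (rule sum_bound)
          fix l
          let ?r = "u t x $ l" and ?f = "F (u t x) x t $ l"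
          have "(\<theta> ?r - ?r) * ?f \<le> \<bar>\<theta> ?r - ?r\<bar> * \<bar>?f\<bar>" by (simp add: abs_mult[symmetric])
          also have "\<dots> \<le> (2 * \<epsilon>) * M"
            using approx(1)[of ?r] order_trans[OF component_le_norm_cart M[OF t0]] \<epsilon>
            by (intro mult_mono) auto
          finally show "tr.v t x $ l \<bullet> ?f \<le> ?r \<bullet> ?f + 2 * \<epsilon> * M" by (simp add: algebra_simps)
        qed
      qed (intro tr.energy_derivative_le(1)[OF t0 P \<delta>(1)[OF t0] \<delta>(3)[OF t0]] integrable_inner_F_u[OF t0 M[OF t0]])+
      have "E' t \<le> - \<delta> t * c * (\<integral>x. (norm (tr.v t x))\<^sup>2 \<partial>lebesgue_on \<Omega>) +
          (\<integral>x. tr.v t x \<bullet> F (u t x) x t \<partial>lebesgue_on \<Omega>)"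
        unfolding E'_def by (rule tr.energy_derivative_le(2)[OF t0 P \<delta>(1)[OF t0] \<delta>(3)[OF t0]])
      moreover have "\<delta>max * c * (N * (4 * (R + 1) * \<epsilon>) * V) + N * (2 * \<epsilon> * M) * V \<le> K * \<epsilon>"
      proof -
        have "K * \<epsilon> - (\<delta>max * c * (N * (4 * (R + 1) * \<epsilon>) * V) + N * (2 * \<epsilon> * M) * V) = N * V * (2 * R) * \<epsilon>"
          by (simp add: K_def algebra_simps)
        also have "\<dots> \<ge> 0" using N V R(1) \<epsilon> by simp
        finally show ?thesis by simp
      qed
      ultimately show ?thesis using a b unfolding L2_norm_u_square by linarith
    qed
    show "\<exists>E E'. continuous_on {0..T} E \<and>
      (\<forall>t\<in>{0..T}. \<bar>E t - (L2_norm \<Omega> (u t))\<^sup>2 / 2\<bar> \<le> K * \<epsilon>) \<and>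
      (\<forall>t\<in>{0<..<T}. (E has_real_derivative E' t) (at t) \<and>
         E' t \<le> - \<delta> t * c * (L2_norm \<Omega> (u t))\<^sup>2 + (\<integral>x. u t x \<bullet> F (u t x) x t \<partial>lebesgue_on \<Omega>) + K * \<epsilon>)"
      using E_cont E_deriv 1 2 by (intro exI[of _ E] exI[of _ E'])
        (auto intro: continuous_on_subset)
  qed
qed

end

section \<open>Approximate differential inequalities\<close>

lemma approx_deriv_le_mono:
  assumes "approx_deriv_le T f h" "\<And>t. 0 < t \<Longrightarrow> t < T \<Longrightarrow> h t \<le> h' t"
  shows "approx_deriv_le T f h'"
proof -
  from assms(1) obtain K where K: "\<And>\<epsilon>. 0 < \<epsilon> \<Longrightarrow> \<epsilon> \<le> 1 \<Longrightarrow> \<exists>E E'. continuous_on {0..T} E \<and>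
     (\<forall>t\<in>{0..T}. \<bar>E t - f t\<bar> \<le> K * \<epsilon>) \<and>
     (\<forall>t\<in>{0<..<T}. (E has_real_derivative E' t) (at t) \<and> E' t \<le> h t + K * \<epsilon>)"
    unfolding approx_deriv_le_def by blast
  show ?thesis
    unfolding approx_deriv_le_def
  proof (intro exI[of _ K] allI impI)
    fix \<epsilon> :: real assume "0 < \<epsilon>" "\<epsilon> \<le> 1"
    from K[OF this] obtain E E' where E: "continuous_on {0..T} E"
     "\<And>t. t \<in> {0..T} \<Longrightarrow> \<bar>E t - f t\<bar> \<le> K * \<epsilon>"
     "\<And>t. t \<in> {0<..<T} \<Longrightarrow> (E has_real_derivative E' t) (at t) \<and> E' t \<le> h t + K * \<epsilon>" by blast
    have "\<forall>t\<in>{0<..<T}. (E has_real_derivative E' t) (at t) \<and> E' t \<le> h' t + K * \<epsilon>"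
    proof
      fix t assume t: "t \<in> {0<..<T}"
      show "(E has_real_derivative E' t) (at t) \<and> E' t \<le> h' t + K * \<epsilon>"
        using E(3)[OF t] assms(2)[of t] t by simp
    qed
    then show "\<exists>E E'. continuous_on {0..T} E \<and> (\<forall>t\<in>{0..T}. \<bar>E t - f t\<bar> \<le> K * \<epsilon>) \<and>
      (\<forall>t\<in>{0<..<T}. (E has_real_derivative E' t) (at t) \<and> E' t \<le> h' t + K * \<epsilon>)"
      using E(1,2) by blast
  qed
qed

lemma le_if_le_add_mult_eps:
  fixes a b :: real
  assumes "\<And>\<epsilon>. 0 < \<epsilon> \<Longrightarrow> \<epsilon> \<le> 1 \<Longrightarrow> a \<le> b + C * \<epsilon>"
  shows "a \<le> b"
proof (rule field_le_epsilon)
  fix e :: real assume e: "e > 0"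
  define \<epsilon> where "\<epsilon> = min 1 (e / (\<bar>C\<bar> + 1))"
  have \<epsilon>: "0 < \<epsilon>" "\<epsilon> \<le> 1" "\<epsilon> \<le> e / (\<bar>C\<bar> + 1)" using e by (auto simp: \<epsilon>_def)
  have "C * \<epsilon> \<le> (\<bar>C\<bar> + 1) * \<epsilon>" using \<epsilon>(1) by (intro mult_right_mono) auto
  also have "\<dots> \<le> e" using \<epsilon>(3) by (simp add: pos_le_divide_eq mult.commute)
  finally show "a \<le> b + e" using assms[OF \<epsilon>(1,2)] by simp
qed

text \<open>On \<open>{0..T}\<close> the function \<open>f\<close> is a uniform limit of the
  continuous functions \<open>E\<close>.\<close>

lemma approx_deriv_le_continuous:
  assumes "approx_deriv_le T f h"
  shows "continuous_on {0..T} f"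
proof -
  from assms obtain K where K: "\<And>\<epsilon>. 0 < \<epsilon> \<Longrightarrow> \<epsilon> \<le> 1 \<Longrightarrow> \<exists>E. continuous_on {0..T} E \<and>
     (\<forall>t\<in>{0..T}. \<bar>E t - f t\<bar> \<le> K * \<epsilon>)"
    unfolding approx_deriv_le_def by blast
  show ?thesis
    unfolding continuous_on_iff
  proof (intro ballI allI impI)
    fix x e :: real assume x: "x \<in> {0..T}" and e: "e > 0"
    define \<epsilon> where "\<epsilon> = min 1 (e / (3 * (\<bar>K\<bar> + 1)))"
    have \<epsilon>: "0 < \<epsilon>" "\<epsilon> \<le> 1" "\<epsilon> \<le> e / (3 * (\<bar>K\<bar> + 1))" using e by (auto simp: \<epsilon>_def)
    have "K * \<epsilon> \<le> (\<bar>K\<bar> + 1) * \<epsilon>" using \<epsilon>(1) by (intro mult_right_mono) auto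
    also have "\<dots> \<le> e / 3" using \<epsilon>(3) by (simp add: field_simps)
    finally have K\<epsilon>: "K * \<epsilon> \<le> e / 3" .
    from K[OF \<epsilon>(1,2)] obtain E where E: "continuous_on {0..T} E"
      "\<And>t. t \<in> {0..T} \<Longrightarrow> \<bar>E t - f t\<bar> \<le> K * \<epsilon>" by blast
    from E(1) x e obtain d where d: "d > 0" "\<And>y. y \<in> {0..T} \<Longrightarrow> dist y x < d \<Longrightarrow> dist (E y) (E x) < e / 3"
      unfolding continuous_on_iff by (metis divide_pos_pos zero_less_numeral)
    have "dist (f y) (f x) < e" if "y \<in> {0..T}" "dist y x < d" for y
      using d(2)[OF that] E(2)[OF that(1)] E(2)[OF x] K\<epsilon> unfolding dist_real_def by linarith
    with d(1) show "\<exists>d>0. \<forall>x'\<in>{0..T}. dist x' x < d \<longrightarrow> dist (f x') (f x) < e" by blast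
  qed
qed

text \<open>Formally the derivative of \<open>\<phi> * f + \<psi>\<close> is at most
  \<open>\<phi> * h + \<phi>' * f + \<psi>'\<close>, where \<open>\<phi> \<ge> 0\<close> allows
  \<open>f'\<close> to be replaced by \<open>h\<close>. The argument is run on the differentiable
  approximations \<open>E\<close>, and then \<epsilon> tends to zero.\<close>

lemma approx_deriv_le_weighted_decreasing:
  fixes \<phi> \<phi>' \<psi> \<psi>' :: "real \<Rightarrow> real"
  assumes A: "approx_deriv_le T f h" and st: "0 \<le> s" "s < t" "t \<le> T"
    and \<phi>: "\<And>r. r \<in> {s..t} \<Longrightarrow> (\<phi> has_real_derivative \<phi>' r) (at r)"
    and \<psi>: "\<And>r. r \<in> {s..t} \<Longrightarrow> (\<psi> has_real_derivative \<psi>' r) (at r)"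
    and \<phi>'_cont: "continuous_on {s..t} \<phi>'" and \<phi>_nonneg: "\<And>r. r \<in> {s..t} \<Longrightarrow> \<phi> r \<ge> 0"
    and le: "\<And>r. s < r \<Longrightarrow> r < t \<Longrightarrow> \<phi> r * h r + \<phi>' r * f r + \<psi>' r \<le> 0"
  shows "\<phi> t * f t + \<psi> t \<le> \<phi> s * f s + \<psi> s"
proof -
  have cont: "continuous_on {s..t} \<phi>" "continuous_on {s..t} \<psi>"
    by (rule DERIV_continuous_on; erule \<phi>[THEN has_field_derivative_at_within] \<psi>[THEN has_field_derivative_at_within])+
  have "bounded (\<phi> ` {s..t})" "bounded (\<phi>' ` {s..t})"
    by (intro compact_imp_bounded compact_continuous_image cont \<phi>'_cont compact_Icc)+
  then obtain L1 L2 where L12: "\<And>r. r \<in> {s..t} \<Longrightarrow> \<bar>\<phi> r\<bar> \<le> L1" "\<And>r. r \<in> {s..t} \<Longrightarrow> \<bar>\<phi>' r\<bar> \<le> L2"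
    unfolding bounded_iff by (metis imageI real_norm_def)
  define L where "L = max L1 L2"
  have L: "\<bar>\<phi> r\<bar> \<le> L" "\<bar>\<phi>' r\<bar> \<le> L" if "r \<in> {s..t}" for r
    using L12[OF that] by (auto simp: L_def)
  from A obtain K where K: "\<And>\<epsilon>. 0 < \<epsilon> \<Longrightarrow> \<epsilon> \<le> 1 \<Longrightarrow> \<exists>E E'. continuous_on {0..T} E \<and>
     (\<forall>t\<in>{0..T}. \<bar>E t - f t\<bar> \<le> K * \<epsilon>) \<and>
     (\<forall>t\<in>{0<..<T}. (E has_real_derivative E' t) (at t) \<and> E' t \<le> h t + K * \<epsilon>)"
    unfolding approx_deriv_le_def by blast
  show ?thesis
  proof (rule le_if_le_add_mult_eps)
    fix \<epsilon> :: real assume \<epsilon>: "0 < \<epsilon>" "\<epsilon> \<le> 1"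
    from K[OF this] obtain E E' where E: "continuous_on {0..T} E"
     "\<And>t. t \<in> {0..T} \<Longrightarrow> \<bar>E t - f t\<bar> \<le> K * \<epsilon>"
     "\<And>t. t \<in> {0<..<T} \<Longrightarrow> (E has_real_derivative E' t) (at t)"
     "\<And>t. t \<in> {0<..<T} \<Longrightarrow> E' t \<le> h t + K * \<epsilon>" by blast
    have err: "\<bar>w * E r - w * f r\<bar> \<le> L * (K * \<epsilon>)" if "r \<in> {s..t}" "\<bar>w\<bar> \<le> L" for r w
      unfolding right_diff_distrib[symmetric] abs_mult using E(2)[of r] that st by (intro mult_mono) auto
    \<comment> \<open>The linear term absorbs two errors of size at most
      \<open>L * K * \<epsilon>\<close>: one from \<open>E' \<le> h + K * \<epsilon>\<close>
      weighted by \<phi>, the other from replacing \<open>E\<close> by \<open>f\<close> next to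
      \<open>\<phi>'\<close>.\<close>
    define Q where "Q r = \<phi> r * E r + \<psi> r - 2 * L * K * \<epsilon> * r" for r
    have "Q t \<le> Q s"
    proof (rule DERIV_nonpos_imp_decreasing_open[OF less_imp_le[OF st(2)]])
      have "continuous_on {s..t} E" by (rule continuous_on_subset[OF E(1)]) (use st in auto)
      then show "continuous_on {s..t} Q" unfolding Q_def by (intro continuous_intros cont)
      fix r assume r: "s < r" "r < t"
      then have r': "r \<in> {s..t}" "r \<in> {0<..<T}" using st by auto
      have "(Q has_real_derivative \<phi>' r * E r + E' r * \<phi> r + \<psi>' r - 2 * L * K * \<epsilon>) (at r)"
        unfolding Q_def[abs_def] using \<phi>[OF r'(1)] \<psi>[OF r'(1)] E(3)[OF r'(2)]
        by (auto intro!: derivative_eq_intros)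
      moreover have "\<phi>' r * E r + E' r * \<phi> r + \<psi>' r - 2 * L * K * \<epsilon> \<le> 0"
      proof -
        have "\<phi> r * E' r \<le> \<phi> r * (h r + K * \<epsilon>)"
          using \<phi>_nonneg[OF r'(1)] E(4)[OF r'(2)] by (rule mult_left_mono[rotated])
        moreover have "K * \<epsilon> \<ge> 0" using E(2)[of r] r' abs_ge_zero order_trans by (metis atLeastAtMost_iff greaterThanLessThan_iff less_imp_le)
        then have "\<phi> r * (K * \<epsilon>) \<le> L * (K * \<epsilon>)"
          using L(1)[OF r'(1)] by (intro mult_right_mono) auto
        ultimately show ?thesis
          using err[OF r'(1) L(2)[OF r'(1)]] le[OF r] by (simp add: algebra_simps abs_le_iff)
      qed
      ultimately show "\<exists>y. (Q has_real_derivative y) (at r) \<and> y \<le> 0" by blast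
    qed
    \<comment> \<open>The part with \<open>t - s\<close> is the change of the linear term; the other
      \<open>2 * L * K\<close> pays for replacing \<open>E\<close> by \<open>f\<close> at the two
      endpoints.\<close>
    then show "\<phi> t * f t + \<psi> t \<le> \<phi> s * f s + \<psi> s + (2 * L * K * (t - s) + 2 * L * K) * \<epsilon>"
      using err[OF _ L(1), of t t] err[OF _ L(1), of s s] st
      by (simp add: Q_def algebra_simps abs_le_iff)
  qed
qed

text \<open>Mean value theorem, with
  \<open>\<xi> powr (e - 1) \<le> \<xi> powr e \<le> M powr e\<close> for \<open>\<xi> > 1\<close>.
  It makes the superlinear term linear in \<open>Y - 1\<close> and so accessible to a Gronwall
  argument.\<close>

lemma powr_minus_one_le:
  fixes x e M :: real
  assumes "1 \<le> x" "x \<le> M" "e > 0"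
  shows "x powr e - 1 \<le> e * M powr e * (x - 1)"
proof (cases "x = 1")
  case False
  then have "1 < x" using assms by simp
  then obtain \<xi> where \<xi>: "1 < \<xi>" "\<xi> < x" "x powr e - 1 powr e = (x - 1) * (e * \<xi> powr (e - 1))"
    using MVT2[of 1 x "\<lambda>x. x powr e" "\<lambda>x. e * x powr (e - 1)"] has_real_derivative_powr[of _ e]
    by auto
  have "\<xi> powr (e - 1) \<le> \<xi> powr e" using \<xi>(1) by (intro powr_mono) auto
  also have "\<dots> \<le> M powr e" using \<xi> assms by (intro powr_mono2) auto
  finally have "(x - 1) * (e * \<xi> powr (e - 1)) \<le> (x - 1) * (e * M powr e)"
    using assms \<xi> by (intro mult_left_mono) auto
  then show ?thesis using \<xi>(3) by (simp add: algebra_simps)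
qed simp

text \<open>With \<open>Y = (g \<mu>)\<^sup>2\<close>, the quantity \<open>exp (- C t) (Y - 1)\<close> is nonincreasing as long as \<open>Y \<ge> 1\<close>.\<close>

lemma comparison_with_supersolution:
  fixes g \<mu> \<rho> \<sigma> \<alpha> :: "real \<Rightarrow> real"
  assumes A: "\<And>T. approx_deriv_le T (\<lambda>t. (g t)\<^sup>2 / 2) (\<lambda>t. (g t)\<^sup>2 * (- \<sigma> t + \<alpha> t * g t powr r))"
    and g: "\<And>t. t \<ge> 0 \<Longrightarrow> g t \<ge> 0" and r: "r > 0"
    and \<mu>_pos: "\<And>t. t \<ge> 0 \<Longrightarrow> \<mu> t > 0"
    and \<mu>: "\<And>t. t \<ge> 0 \<Longrightarrow> (\<mu> has_real_derivative \<rho> t * \<mu> t) (at t)"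
    and \<rho>: "continuous_on {0..} \<rho>"
    and \<alpha>: "\<And>t. t \<ge> 0 \<Longrightarrow> \<alpha> t \<le> \<mu> t powr r * (\<sigma> t - \<rho> t)"
    and \<beta>: "\<And>t. t \<ge> 0 \<Longrightarrow> 0 \<le> \<sigma> t - \<rho> t" "\<And>t. t \<ge> 0 \<Longrightarrow> \<sigma> t - \<rho> t \<le> \<beta>"
    and init: "g 0 * \<mu> 0 \<le> 1" and t: "t \<ge> 0"
  shows "g t * \<mu> t \<le> 1"
proof (rule ccontr)
  assume "\<not> g t * \<mu> t \<le> 1"
  define Y where "Y \<tau> = (g \<tau>)\<^sup>2 * (\<mu> \<tau>)\<^sup>2" for \<tau>
  have Y_alt: "Y \<tau> = (g \<tau> * \<mu> \<tau>)\<^sup>2" for \<tau> by (simp add: Y_def power_mult_distrib)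
  have Y_nonneg: "Y \<tau> \<ge> 0" for \<tau> by (simp add: Y_alt)
  have Yt: "Y t > 1" using \<open>\<not> g t * \<mu> t \<le> 1\<close> unfolding Y_alt by (intro one_less_power) auto
  have Y0: "Y 0 \<le> 1" unfolding Y_alt using init g[of 0] \<mu>_pos[of 0] by (intro power_le_one) auto
  have \<mu>_cont: "continuous_on {0..} \<mu>"
    by (rule DERIV_continuous_on[OF \<mu>[THEN has_field_derivative_at_within]]) simp
  \<comment> \<open>Written with \<open>(g \<tau>)\<^sup>2 / 2\<close>, the function for which
    continuity follows from the approximate differential inequality.\<close>
  have "continuous_on {0..t} (\<lambda>\<tau>. 2 * ((g \<tau>)\<^sup>2 / 2) * (\<mu> \<tau>)\<^sup>2)"
    by (intro continuous_intros approx_deriv_le_continuous[OF A] continuous_on_subset[OF \<mu>_cont]) auto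
  then have Y_cont: "continuous_on {0..t} Y" by (simp add: Y_def[abs_def])
  have "compact (Y ` {0..t})" by (intro compact_continuous_image Y_cont compact_Icc)
  then obtain M where M: "\<And>\<tau>. \<tau> \<in> {0..t} \<Longrightarrow> Y \<tau> \<le> M"
    using bounded_imp_bdd_above[OF compact_imp_bounded] unfolding bdd_above_def by (metis imageI)
  \<comment> \<open>The largest element \<open>s\<close> of \<open>S\<close> is the last time with
    \<open>Y \<le> 1\<close>; on the rest of the interval up to \<open>t\<close> the lower bound
    \<open>Y > 1\<close> is available.\<close>
  define S where "S = {\<tau> \<in> {0..t}. Y \<tau> \<le> 1}"
  have "closed S"
    using continuous_closed_preimage[OF Y_cont closed_atLeastAtMost closed_atMost[of 1]]
    by (simp add: S_def vimage_def Int_def)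
  moreover have "bounded S" by (rule bounded_subset[of "{0..t}"]) (auto simp: S_def)
  ultimately have "compact S" by (simp add: compact_eq_bounded_closed)
  then obtain s where s: "s \<in> S" "\<And>\<tau>. \<tau> \<in> S \<Longrightarrow> \<tau> \<le> s"
    using compact_attains_sup[of S] Y0 t by (auto simp: S_def)
  have st: "0 \<le> s" "s < t" using s(1) Yt by (auto simp: S_def order.order_iff_strict)
  have Y_gt: "Y \<tau> > 1" if "s < \<tau>" "\<tau> \<le> t" for \<tau>
  proof -
    have "\<tau> \<notin> S" using s(2)[of \<tau>] that(1) by linarith
    then show ?thesis using that st by (simp add: S_def)
  qed
  have M1: "M \<ge> 1" using M[of t] Yt t by simp
  \<comment> \<open>The exponent is halved because \<open>Y\<close> is the square of
    \<open>g * \<mu>\<close>; \<kappa> is the slope in the linear bound for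
    \<open>Y powr e - 1\<close> on \<open>[1, M]\<close>.\<close>
  define e \<kappa> where "e = r / 2" and "\<kappa> = e * M powr e"
  have e: "e > 0" using r by (simp add: e_def)
  have \<kappa>: "\<kappa> \<ge> 0" using e by (simp add: \<kappa>_def)
  have \<beta>0: "\<beta> \<ge> 0" using \<beta>(1,2)[of 0] by simp
  \<comment> \<open>Chosen so that
    \<open>2 * Y * (\<kappa> * (Y - 1)) * \<beta> \<le> C * (Y - 1)\<close> whenever
    \<open>1 \<le> Y \<le> M\<close>.\<close>
  define C where "C = 2 * M * \<beta> * \<kappa>"
  \<comment> \<open>With these weights \<open>\<phi> * (g^2 / 2) + \<psi>\<close> equals
    \<open>exp (- C * \<tau>) * (Y \<tau> - 1)\<close>.\<close>
  define \<phi> \<psi> where "\<phi> \<tau> = 2 * (\<mu> \<tau>)\<^sup>2 * exp (- C * \<tau>)" and "\<psi> \<tau> = - exp (- C * \<tau>)" for \<tau>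
  have "\<phi> t * ((g t)\<^sup>2 / 2) + \<psi> t \<le> \<phi> s * ((g s)\<^sup>2 / 2) + \<psi> s"
  proof (rule approx_deriv_le_weighted_decreasing[OF A st order_refl])
    fix \<tau> assume "\<tau> \<in> {s..t}"
    then have \<tau>: "\<tau> \<ge> 0" using st by auto
    show "(\<phi> has_real_derivative (2 * \<rho> \<tau> - C) * \<phi> \<tau>) (at \<tau>)"
      unfolding \<phi>_def[abs_def]
      by (auto intro!: derivative_eq_intros \<mu>[OF \<tau>] simp: algebra_simps power2_eq_square)
    show "(\<psi> has_real_derivative C * exp (- C * \<tau>)) (at \<tau>)"
      unfolding \<psi>_def[abs_def] by (auto intro!: derivative_eq_intros)
    show "\<phi> \<tau> \<ge> 0" by (simp add: \<phi>_def)
  next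
    show "continuous_on {s..t} (\<lambda>\<tau>. (2 * \<rho> \<tau> - C) * \<phi> \<tau>)"
      unfolding \<phi>_def using st
      by (intro continuous_intros continuous_on_subset[OF \<mu>_cont] continuous_on_subset[OF \<rho>]) auto
  next
    fix \<tau> assume \<tau>: "s < \<tau>" "\<tau> < t"
    then have \<tau>0: "\<tau> \<ge> 0" using st by simp
    have Y1: "1 \<le> Y \<tau>" "Y \<tau> \<le> M" using Y_gt[of \<tau>] M[of \<tau>] \<tau> st by auto
    \<comment> \<open>The supersolution condition reduces the logarithmic growth rate of
      \<open>g * \<mu>\<close> to \<open>(Y powr e - 1) * (\<sigma> - \<rho>)\<close>, which
      vanishes at \<open>Y = 1\<close>.\<close>
    have "\<alpha> \<tau> * g \<tau> powr r \<le> (\<mu> \<tau> powr r * (\<sigma> \<tau> - \<rho> \<tau>)) * g \<tau> powr r"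
      by (intro mult_right_mono \<alpha> \<tau>0) simp
    also have "\<dots> = (g \<tau> * \<mu> \<tau>) powr r * (\<sigma> \<tau> - \<rho> \<tau>)"
      using g[OF \<tau>0] \<mu>_pos[OF \<tau>0] by (simp add: powr_mult)
    also have "(g \<tau> * \<mu> \<tau>) powr r = Y \<tau> powr e"
    proof -
      have "Y \<tau> powr e = ((g \<tau> * \<mu> \<tau>) powr 2) powr e"
        using g[OF \<tau>0] \<mu>_pos[OF \<tau>0] by (simp add: Y_alt)
      then show ?thesis by (simp add: powr_powr e_def)
    qed
    finally have "- \<sigma> \<tau> + \<alpha> \<tau> * g \<tau> powr r + \<rho> \<tau> \<le> (Y \<tau> powr e - 1) * (\<sigma> \<tau> - \<rho> \<tau>)"
      by (simp add: algebra_simps)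
    also have "\<dots> \<le> (\<kappa> * (Y \<tau> - 1)) * (\<sigma> \<tau> - \<rho> \<tau>)"
      using powr_minus_one_le[OF Y1 e] \<beta>(1)[OF \<tau>0] by (intro mult_right_mono) (auto simp: \<kappa>_def)
    also have "\<dots> \<le> (\<kappa> * (Y \<tau> - 1)) * \<beta>"
      using \<beta>(2)[OF \<tau>0] \<kappa> Y1 by (intro mult_left_mono) auto
    finally have "Y \<tau> * (- \<sigma> \<tau> + \<alpha> \<tau> * g \<tau> powr r + \<rho> \<tau>) \<le> Y \<tau> * ((\<kappa> * (Y \<tau> - 1)) * \<beta>)"
      using Y_nonneg by (intro mult_left_mono) auto
    also have "\<dots> \<le> M * ((\<kappa> * (Y \<tau> - 1)) * \<beta>)"
      using Y1 \<kappa> \<beta>0 by (intro mult_right_mono) auto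
    finally have "2 * Y \<tau> * (- \<sigma> \<tau> + \<alpha> \<tau> * g \<tau> powr r + \<rho> \<tau>) - C * (Y \<tau> - 1) \<le> 0"
      by (simp add: C_def algebra_simps)
    then have "exp (- C * \<tau>) * (2 * Y \<tau> * (- \<sigma> \<tau> + \<alpha> \<tau> * g \<tau> powr r + \<rho> \<tau>) - C * (Y \<tau> - 1)) \<le> 0"
      by (simp add: mult_le_0_iff)
    then show "\<phi> \<tau> * ((g \<tau>)\<^sup>2 * (- \<sigma> \<tau> + \<alpha> \<tau> * g \<tau> powr r)) +
        (2 * \<rho> \<tau> - C) * \<phi> \<tau> * ((g \<tau>)\<^sup>2 / 2) + C * exp (- C * \<tau>) \<le> 0"
      by (simp add: \<phi>_def Y_def algebra_simps)
  qed
  then have "exp (- C * t) * (Y t - 1) \<le> exp (- C * s) * (Y s - 1)"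
    by (simp add: \<phi>_def \<psi>_def Y_def algebra_simps)
  also have "\<dots> \<le> 0" using s(1) by (simp add: S_def mult_le_0_iff)
  finally show False using Yt by (simp add: mult_le_0_iff)
qed

section \<open>Decay of the solution\<close>

text \<open>Pointwise, Cauchy-Schwarz bounds the part with \<open>B\<close> by \<open>b\<close>
  times the power \<open>p + 1\<close> of the norm. The factor of power \<open>p - 1\<close> is at
  most \<open>L powr (p - 1)\<close> almost everywhere, which leaves the square of the norm to
  integrate.\<close>

lemma (in dirichlet_flow) integral_inner_F_u_le:
  assumes t: "t > 0" and p: "p > 1" and M: "\<And>v x. norm (F v x t) \<le> M"
    and F: "\<And>v x. F v x t = A x *v v + B v x"
    and A: "\<And>v x. x \<in> \<Omega> \<Longrightarrow> (A x *v v) \<bullet> v \<le> - \<gamma> * (norm v)\<^sup>2"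
    and B: "\<And>v x. x \<in> \<Omega> \<Longrightarrow> norm (B v x) \<le> b * norm v powr p" and b: "b \<ge> 0"
    and L: "Linf_norm \<Omega> (u t) \<le> ereal L"
  shows "(\<integral>x. u t x \<bullet> F (u t x) x t \<partial>lebesgue_on \<Omega>) \<le> (- \<gamma> + b * L powr (p - 1)) * (L2_norm \<Omega> (u t))\<^sup>2"
proof -
  let ?C = "- \<gamma> + b * L powr (p - 1)"
  have pt: "u t x \<bullet> F (u t x) x t \<le> ?C * (norm (u t x))\<^sup>2" if x: "x \<in> \<Omega>" and le: "norm (u t x) \<le> L" for x
  proof -
    let ?n = "norm (u t x)"
    have "u t x \<bullet> B (u t x) x \<le> ?n * norm (B (u t x) x)" by (rule norm_cauchy_schwarz)
    also have "\<dots> \<le> ?n * (b * ?n powr p)" by (intro mult_left_mono B x) simp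
    also have "\<dots> = b * ?n powr (p - 1) * ?n\<^sup>2"
      by (cases "?n = 0") (auto simp: powr_diff power2_eq_square)
    also have "\<dots> \<le> b * L powr (p - 1) * ?n\<^sup>2"
      using b p le by (intro mult_right_mono mult_left_mono powr_mono2) auto
    finally show ?thesis
      using A[OF x, of "u t x"] by (simp add: F inner_add_right inner_commute algebra_simps)
  qed
  have "AE x in lebesgue_on \<Omega>. ereal (norm (u t x)) \<le> Linf_norm \<Omega> (u t)"
    unfolding Linf_norm_def by (rule esssup_AE)
  then have ae: "AE x in lebesgue_on \<Omega>. norm (u t x) \<le> L"
    by eventually_elim (use L order_trans in \<open>fastforce\<close>)
  have "(\<integral>x. u t x \<bullet> F (u t x) x t \<partial>lebesgue_on \<Omega>) \<le> (\<integral>x. ?C * (norm (u t x))\<^sup>2 \<partial>lebesgue_on \<Omega>)"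
  proof (rule integral_mono_AE)
    show "integrable (lebesgue_on \<Omega>) (\<lambda>x. u t x \<bullet> F (u t x) x t)" by (rule integrable_inner_F_u[OF t M])
    show "integrable (lebesgue_on \<Omega>) (\<lambda>x. ?C * (norm (u t x))\<^sup>2)"
      using integrable_norm_square_u t by simp
    show "AE x in lebesgue_on \<Omega>. u t x \<bullet> F (u t x) x t \<le> ?C * (norm (u t x))\<^sup>2"
      using ae AE_space by eventually_elim (use pt in simp)
  qed
  then show ?thesis by (simp add: L2_norm_u_square)
qed

theorem theorem3p2:
  fixes \<Omega> :: "(real ^ 'm::finite) set"
    and D :: "real \<Rightarrow> real ^ 'n::finite ^ 'n"
    and A :: "real ^ 'm \<Rightarrow> real \<Rightarrow> real ^ 'n ^ 'n"
    and B F :: "real ^ 'n \<Rightarrow> real ^ 'm \<Rightarrow> real \<Rightarrow> real ^ 'n"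
    and u\<^sub>0 :: "real ^ 'm \<Rightarrow> real ^ 'n"
    and u :: "real \<Rightarrow> real ^ 'm \<Rightarrow> real ^ 'n"
    and d \<gamma> c\<^sub>0 \<sigma> \<alpha> \<mu> g :: "real \<Rightarrow> real"
    and M\<^sub>1 c_F p q c_\<Omega> c d\<^sub>0 \<gamma>\<^sub>0 \<mu>\<^sub>0 k m :: real
  assumes dim: "CARD('m) \<le> 3"
    and domain: "smooth_bounded_domain \<Omega>"
    and D_diag: "\<And>t i j. t \<ge> 0 \<Longrightarrow> i \<noteq> j \<Longrightarrow> D t $ i $ j = 0"
    and D_pos: "\<And>t i. t \<ge> 0 \<Longrightarrow> D t $ i $ i > 0"
    and D_lower: "\<And>t i. t \<ge> 0 \<Longrightarrow> D t $ i $ i \<ge> d t"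
    and d_pos: "\<And>t. t \<ge> 0 \<Longrightarrow> d t > 0"
    and F_def: "\<And>v x t. t \<ge> 0 \<Longrightarrow> F v x t = A x t *v v + B v x t"
    and F_zero: "\<And>x t. x \<in> \<Omega> \<Longrightarrow> t \<ge> 0 \<Longrightarrow> F 0 x t = 0"
    and F_bounded: "\<And>v x t. t \<ge> 0 \<Longrightarrow> norm (F v x t) \<le> M\<^sub>1"
    and c_F_pos: "c_F > 0"
    and F_lipschitz: "\<And>v w x t s. t \<ge> 0 \<Longrightarrow> s \<ge> 0 \<Longrightarrow>
          norm (F v x t - F w x s) \<le> c_F * (\<bar>t - s\<bar> + norm (v - w))"
    and F_cont: "\<And>v t. t \<ge> 0 \<Longrightarrow> continuous_on UNIV (\<lambda>x. F v x t)"
    and A_bound: "\<And>v x t. x \<in> \<Omega> \<Longrightarrow> t \<ge> 0 \<Longrightarrow> (A x t *v v) \<bullet> v \<le> - \<gamma> t * (norm v)\<^sup>2"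
    and p_gt_1: "p > 1"
    and B_bound: "\<And>v x t. x \<in> \<Omega> \<Longrightarrow> t \<ge> 0 \<Longrightarrow> norm (B v x t) \<le> c\<^sub>0 t * norm v powr p"
    and compat: "\<And>x. x \<in> frontier \<Omega> \<Longrightarrow> u\<^sub>0 x = 0"
    and solution: "classical_solution \<Omega> D F u\<^sub>0 u"
    and u_H2: "\<And>t. t \<ge> 0 \<Longrightarrow> in_Hk 2 \<Omega> (u t)"
    and g_def: "\<And>t. t \<ge> 0 \<Longrightarrow> g t = L2_norm \<Omega> (u t)"
    and g_0: "g 0 \<noteq> 0"
    and c_\<Omega>_pos: "c_\<Omega> > 0"
    and poincare: "poincare_constant TYPE(real ^ 'n) \<Omega> c_\<Omega>"
    and c_pos: "c > 0"
    and interpolation: "interpolation_constant TYPE(real ^ 'n) \<Omega> c"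
    and \<sigma>_def: "\<And>t. t \<ge> 0 \<Longrightarrow> \<sigma> t = d t * c_\<Omega> + \<gamma> t"
    and \<alpha>_def: "\<And>t. t \<ge> 0 \<Longrightarrow>
          \<alpha> t = c\<^sub>0 t * c powr (p - 1) * Hk_norm 2 \<Omega> (u t) powr (3 * (p - 1) / 4)"
    and q_def: "q = (p + 3) / 4"
    and \<sigma>_cont: "continuous_on {0..} \<sigma>"
    and \<alpha>_cont: "continuous_on {0..} \<alpha>"
    and \<alpha>_nonneg: "\<And>t. t \<ge> 0 \<Longrightarrow> \<alpha> t \<ge> 0"
    and consts_pos: "d\<^sub>0 > 0" "\<gamma>\<^sub>0 > 0" "\<mu>\<^sub>0 > 0"
    and k_ge_1: "k \<ge> 1"
    and d_eq: "\<And>t. t \<ge> 0 \<Longrightarrow> d t = d\<^sub>0 / (t + 1)"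
    and \<gamma>_eq: "\<And>t. t \<ge> 0 \<Longrightarrow> \<gamma> t = - \<gamma>\<^sub>0 / (t + 1) powr k"
    and \<mu>_eq: "\<And>t. t \<ge> 0 \<Longrightarrow> \<mu> t = \<mu>\<^sub>0 * (t + 1) powr m"
    and \<alpha>_bound: "\<And>t. t \<ge> 0 \<Longrightarrow>
          \<alpha> t \<le> \<mu>\<^sub>0 powr (q - 1) * (t + 1) powr (m * (q - 1))
                 * (c_\<Omega> * (d\<^sub>0 / (t + 1)) - \<gamma>\<^sub>0 / (t + 1) powr k - m / (t + 1))"
    and decay: "c_\<Omega> * d\<^sub>0 > \<gamma>\<^sub>0 + m"
    and \<mu>\<^sub>0_eq: "\<mu>\<^sub>0 = inverse (g 0)"
  shows "\<forall>t\<ge>0. L2_norm \<Omega> (u t) \<le> g 0 * (t + 1) powr (- m)"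
proof -
  interpret dirichlet_flow \<Omega> D F u\<^sub>0 u
    by unfold_locales (use domain D_diag solution in \<open>auto simp: smooth_bounded_domain_def\<close>)
  define G where "G t = L2_norm \<Omega> (u t)" for t
  have G_nonneg: "G t \<ge> 0" for t by (simp add: G_def L2_norm_def)
  \<comment> \<open>A unit vector in the bound for \<open>B\<close> isolates the coefficient, since
    \<open>1 powr p = 1\<close>.\<close>
  have c\<^sub>0: "c\<^sub>0 t \<ge> 0" if "t \<ge> 0" for t
  proof -
    obtain x where "x \<in> \<Omega>" using domain by (auto simp: smooth_bounded_domain_def)
    from B_bound[OF this that, of "axis undefined 1"] show ?thesis
      using order_trans[OF norm_ge_zero] by (simp add: norm_axis_1)
  qed
  \<comment> \<open>The power \<open>1 / 4\<close> of the \<open>L^2\<close> norm in the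
    interpolation inequality, raised to \<open>p - 1\<close>, gives the exponent
    \<open>q - 1\<close>.\<close>
  have r: "q - 1 > 0" "q - 1 = (p - 1) / 4" using p_gt_1 q_def by auto
  have inner_F: "(\<integral>x. u t x \<bullet> F (u t x) x t \<partial>lebesgue_on \<Omega>) \<le> (- \<gamma> t + \<alpha> t * G t powr (q - 1)) * (G t)\<^sup>2"
    if t: "t > 0" for t
  proof -
    let ?H = "Hk_norm 2 \<Omega> (u t)"
    define L where "L = c * G t powr (1 / 4) * ?H powr (3 / 4)"
    have H: "?H \<ge> 0" by (simp add: Hk_norm_def sum_nonneg)
    have "Linf_norm \<Omega> (u t) \<le> ereal L"
      using interpolation u_H2[of t] t unfolding interpolation_constant_def L_def G_def by simp
    then have "(\<integral>x. u t x \<bullet> F (u t x) x t \<partial>lebesgue_on \<Omega>) \<le> (- \<gamma> t + c\<^sub>0 t * L powr (p - 1)) * (G t)\<^sup>2"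
      unfolding G_def using t
      by (intro integral_inner_F_u_le[OF t p_gt_1, where A = "\<lambda>x. A x t" and B = "\<lambda>v x. B v x t" and M = M\<^sub>1]
          F_bounded F_def A_bound B_bound c\<^sub>0) auto
    \<comment> \<open>Together with the factor \<open>c\<^sub>0 t\<close>, the powers of
      \<open>c\<close> and of the \<open>H^2\<close> norm make up \<open>\<alpha> t\<close>.\<close>
    also have "L powr (p - 1) = c powr (p - 1) * G t powr (q - 1) * ?H powr (3 * (p - 1) / 4)"
      using c_pos H G_nonneg[of t] by (simp add: L_def powr_mult powr_powr r(2))
    finally show ?thesis using t by (simp add: \<alpha>_def algebra_simps)
  qed
  have A: "approx_deriv_le T (\<lambda>t. (G t)\<^sup>2 / 2) (\<lambda>t. (G t)\<^sup>2 * (- \<sigma> t + \<alpha> t * G t powr (q - 1)))" for T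
    unfolding G_def
  proof (rule approx_deriv_le_mono[OF energy_inequality[OF poincare less_imp_le[OF c_\<Omega>_pos]]])
    fix t :: real and v x l assume t: "t > 0"
    show "norm (F v x t) \<le> M\<^sub>1" "0 \<le> d t" "d t \<le> D t $ l $ l"
      using t F_bounded d_pos[of t] D_lower by auto
    \<comment> \<open>The uniform bound \<open>\<delta>max\<close> is \<open>d\<^sub>0\<close>, the
      value of \<open>d\<close> at time \<open>0\<close>.\<close>
    show "d t \<le> d\<^sub>0" using d_eq[of t] t consts_pos(1) by (simp add: divide_le_eq mult_le_cancel_left1)
    show "- d t * c_\<Omega> * (L2_norm \<Omega> (u t))\<^sup>2 + (\<integral>x. u t x \<bullet> F (u t x) x t \<partial>lebesgue_on \<Omega>)
        \<le> (L2_norm \<Omega> (u t))\<^sup>2 * (- \<sigma> t + \<alpha> t * L2_norm \<Omega> (u t) powr (q - 1))"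
      using inner_F[OF t] t unfolding G_def by (simp add: \<sigma>_def algebra_simps)
  qed
  let ?\<mu> = "\<lambda>t. \<mu>\<^sub>0 * (t + 1) powr m"
  have \<beta>: "\<sigma> t - m / (t + 1) = c_\<Omega> * (d\<^sub>0 / (t + 1)) - \<gamma>\<^sub>0 / (t + 1) powr k - m / (t + 1)" if "t \<ge> 0" for t
    using that by (simp add: \<sigma>_def d_eq \<gamma>_eq mult.commute)
  have \<alpha>_le: "\<alpha> t \<le> ?\<mu> t powr (q - 1) * (\<sigma> t - m / (t + 1))" if "t \<ge> 0" for t
    using \<alpha>_bound[OF that] that consts_pos(3) by (simp add: \<beta>[OF that] powr_mult powr_powr)
  \<comment> \<open>The logarithmic derivative of \<open>\<mu>\<^sub>0 * (t + 1) powr m\<close> is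
    \<open>m / (t + 1)\<close>, which is taken for \<rho>.\<close>
  have comparison: "G t * ?\<mu> t \<le> 1" if t: "t \<ge> 0" for t
  proof (rule comparison_with_supersolution[OF A G_nonneg r(1), where \<rho> = "\<lambda>t. m / (t + 1)"
        and \<beta> = "c_\<Omega> * d\<^sub>0 + \<bar>m\<bar>"])
    fix t :: real assume t: "t \<ge> 0"
    show "?\<mu> t > 0" using t consts_pos(3) by simp
    show "(?\<mu> has_real_derivative m / (t + 1) * ?\<mu> t) (at t)"
      using t by (auto intro!: derivative_eq_intros simp: powr_diff)
    show "\<alpha> t \<le> ?\<mu> t powr (q - 1) * (\<sigma> t - m / (t + 1))" by (rule \<alpha>_le[OF t])
    \<comment> \<open>The sign of \<open>\<sigma> t - m / (t + 1)\<close> follows from squeezing the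
      nonnegative \<open>\<alpha> t\<close> below its product with a positive power of
      \<open>?\<mu> t\<close>.\<close>
    have "0 \<le> ?\<mu> t powr (q - 1) * (\<sigma> t - m / (t + 1))" using \<alpha>_le[OF t] \<alpha>_nonneg[OF t] by simp
    then show "0 \<le> \<sigma> t - m / (t + 1)" using t consts_pos(3) by (simp add: zero_le_mult_iff)
    have "c_\<Omega> * (d\<^sub>0 / (t + 1)) \<le> c_\<Omega> * d\<^sub>0"
      using c_\<Omega>_pos consts_pos(1) t by (intro mult_left_mono) (auto simp: field_simps)
    moreover have "- (m / (t + 1)) \<le> \<bar>m\<bar>"
    proof -
      have "- (m / (t + 1)) \<le> \<bar>m / (t + 1)\<bar>" by (rule abs_ge_minus_self)
      also have "\<dots> \<le> \<bar>m\<bar>" using t by (simp add: abs_divide divide_le_eq mult_le_cancel_left1)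
      finally show ?thesis .
    qed
    moreover have "\<gamma>\<^sub>0 / (t + 1) powr k \<ge> 0" using consts_pos(2) by simp
    ultimately show "\<sigma> t - m / (t + 1) \<le> c_\<Omega> * d\<^sub>0 + \<bar>m\<bar>" unfolding \<beta>[OF t] by linarith
  next
    show "continuous_on {0..} (\<lambda>t. m / (t + 1))" by (intro continuous_intros) auto
    \<comment> \<open>The choice of \<open>\<mu>\<^sub>0\<close> gives equality at the initial
      time.\<close>
    show "G 0 * ?\<mu> 0 \<le> 1" using g_0 g_def[of 0] by (simp add: \<mu>\<^sub>0_eq G_def)
  qed (use t in auto)
  show ?thesis
  proof (intro allI impI)
    fix t :: real assume t: "t \<ge> 0"
    have "g 0 > 0" using consts_pos(3) \<mu>\<^sub>0_eq by simp
    then show "L2_norm \<Omega> (u t) \<le> g 0 * (t + 1) powr (- m)"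
      using comparison[OF t] t by (simp add: G_def \<mu>\<^sub>0_eq powr_minus field_simps)
  qed
qed

end
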